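(* Let $I\subset\mathbb R\setminus\{0\}$ be an open interval and $f:I\to\mathbb R$ smooth with $f'^2>1$ and $f''\neq0$ everywhere on $I$. If the differential equation $$\frac{f'''}{f''}=\frac{s(3f'^2+2)f''+2f'(f'^2-1)}{sf'(f'^2-1)}$$ holds on $I$, then the rotational hypersurface $\Gamma^t(s,t,w)=(f(s),\ -s\cos t\sin w,\ -s\sin t,\ s\cos t\cos w)$ in $\mathbb E_1^4$ with Gauss map $N^t=\frac1{\sqrt{f'^2-1}}(1,\ -f'\cos t\sin w,\ -f'\sin t,\ f'\cos t\cos w)$ has first kind $L_2$-pointwise 1-type Gauss map, i.e. $L_2N^t=\mathfrak mN^t$ for some non-zero smooth function $\mathfrak m$.
   Context: $\mathbb E_1^4$ is $\mathbb R^4$ with the Lorentzian metric $\langle\,,\rangle=-dx_1^2+dx_2^2+dx_3^2+dx_4^2$. Let $M$ be an oriented hypersurface of $\mathbb E_1^4$ with nondegenerate induced metric $g$, unit normal vector field (Gauss map) $N$, $\varepsilon=\langle N,N\rangle=\pm1$, shape operator $S=-dN$ and principal curvatures $\kappa_1,\kappa_2,\kappa_3$. Put $a_0=1$, $a_1=-(\kappa_1+\kappa_2+\kappa_3)$, $a_2=\kappa_1\kappa_2+\kappa_1\kappa_3+\kappa_2\kappa_3$, $a_3=-\kappa_1\kappa_2\kappa_3$. The Newton transformations are $P_0=I$, $P_k=a_kI+S\circ P_{k-1}$, and $L_k(\varphi)=\mathrm{tr}(P_k\circ\nabla^2\varphi)$ for $\varphi\in C^\infty(M)$, where $\nabla^2\varphi$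 is the Hessian operator of $\varphi$ with respect to $g$; $L_k$ acts componentwise on $\mathbb R^4$-valued functions such as $N$. With $n=3$, $\binom{n}{k}H_k=(-\varepsilon)^ka_k$ and $C_k=\binom{n}{k+1}(-\varepsilon)^k$, the known formula used for the Gauss map is $L_kN=-\varepsilon C_k\big(\nabla H_{k+1}+(nH_1H_{k+1}-(n-k-1)H_{k+2})N\big)$, where $\nabla$ is the gradient of $g$ (for $k=2$ the last term has coefficient $0$). $M$ has first kind $L_k$-pointwise 1-type Gauss map if $L_kN=\mathfrak mN$ for a non-zero (i.e. not identically zero) smooth function $\mathfrak m$ on $M$. Primes denote $d/ds$; $s\in I$, $0\le t,w\le2\pi$, and the parametrization is considered where it is an immersion ($\cos t\neq0$). *)

theory Defs
  imports "HOL-Analysis.Analysis"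
begin

section \<open>Partial derivatives and smoothness\<close>

definition partial_deriv ::
  "'a::euclidean_space \<Rightarrow> ('a \<Rightarrow> 'b::real_normed_vector) \<Rightarrow> 'a \<Rightarrow> 'b"
  where "partial_deriv b \<phi> p = vector_derivative (\<lambda>h. \<phi> (p + h *\<^sub>R b)) (at 0)"

text \<open>
  Intended for open \<open>U\<close>: if every iterated partial derivative of \<open>\<phi>\<close> is (Frechet)
  differentiable at every point of \<open>U\<close>, then \<open>\<phi>\<close> has continuous partial derivatives of all orders
  on \<open>U\<close>, and conversely. The values of \<open>\<phi>\<close> outside \<open>U\<close> play no role.
\<close>

definition smooth_on :: "'a::euclidean_space set \<Rightarrow> ('a \<Rightarrow> 'b::real_normed_vector) \<Rightarrow> bool"
  where "smooth_on U \<phi> \<longleftrightarrow>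
    (\<forall>bs. set bs \<subseteq> Basis \<longrightarrow> (\<forall>p\<in>U. foldr partial_deriv bs \<phi> differentiable (at p)))"

abbreviation pd :: "3 \<Rightarrow> (real^3 \<Rightarrow> 'b::real_normed_vector) \<Rightarrow> real^3 \<Rightarrow> 'b"
  where "pd i \<equiv> partial_deriv (axis i 1)"

section \<open>Parametrized hypersurfaces of Lorentz-Minkowski space\<close>

definition lorentz :: "real^4 \<Rightarrow> real^4 \<Rightarrow> real"
  where "lorentz x y = - (x$1 * y$1) + x$2 * y$2 + x$3 * y$3 + x$4 * y$4"

text \<open>
  Below \<open>X\<close> is a parametrization and \<open>N\<close> a vector field along it, both functions of the
  parameters. Tangent vectors are written in the coordinate frame \<open>pd i X\<close>, and
  an endomorphism of the tangent space is represented by the matrix \<open>A\<close> that sends the \<open>j\<close>-th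
  frame vector to the combination of the \<open>i\<close>-th ones with coefficients \<open>A $ i $ j\<close>; hence
  composition is the matrix product and the trace is the matrix trace.
\<close>

definition metric :: "(real^3 \<Rightarrow> real^4) \<Rightarrow> real^3 \<Rightarrow> real^3^3"
  where "metric X p = (\<chi> i j. lorentz (pd i X p) (pd j X p))"

definition inv_metric :: "(real^3 \<Rightarrow> real^4) \<Rightarrow> real^3 \<Rightarrow> real^3^3"
  where "inv_metric X p = matrix_inv (metric X p)"

definition oriented_hypersurface ::
  "(real^3 \<Rightarrow> real^4) \<Rightarrow> (real^3 \<Rightarrow> real^4) \<Rightarrow> (real^3) set \<Rightarrow> bool"
  where "oriented_hypersurface X N U \<longleftrightarrow>
    open U \<and> smooth_on U X \<and> smooth_on U N \<and>
    (\<forall>p\<in>U. invertible (metric X p)) \<and>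
    (\<forall>p\<in>U. \<forall>i. lorentz (pd i X p) (N p) = 0) \<and>
    (\<exists>\<epsilon>\<in>{-1, 1}. \<forall>p\<in>U. lorentz (N p) (N p) = \<epsilon>)"

text \<open>The shape operator is \<open>S = - dN\<close>.\<close>

definition shape :: "(real^3 \<Rightarrow> real^4) \<Rightarrow> (real^3 \<Rightarrow> real^4) \<Rightarrow> real^3 \<Rightarrow> real^3^3"
  where "shape X N p =
    (THE A. \<forall>j. - pd j N p = (\<Sum>i\<in>UNIV. A$i$j *\<^sub>R pd i X p))"

text \<open>
  The principal curvatures are the roots, with multiplicity, of the characteristic polynomial of
  the shape operator, which is presupposed to split over the reals. They are determined up to
  order, and only symmetric functions of them are used.
\<close>

definition principal_curvatures ::
  "(real^3 \<Rightarrow> real^4) \<Rightarrow> (real^3 \<Rightarrow> real^4) \<Rightarrow> real^3 \<Rightarrow> real^3"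
  where "principal_curvatures X N p =
    (SOME \<kappa>. \<forall>x. det (mat x - shape X N p) = (x - \<kappa>$1) * (x - \<kappa>$2) * (x - \<kappa>$3))"

definition curv_coeff ::
  "(real^3 \<Rightarrow> real^4) \<Rightarrow> (real^3 \<Rightarrow> real^4) \<Rightarrow> real^3 \<Rightarrow> nat \<Rightarrow> real"
  where "curv_coeff X N p k =
    (let \<kappa> = principal_curvatures X N p in
      if k = 0 then 1
      else if k = 1 then - (\<kappa>$1 + \<kappa>$2 + \<kappa>$3)
      else if k = 2 then \<kappa>$1 * \<kappa>$2 + \<kappa>$1 * \<kappa>$3 + \<kappa>$2 * \<kappa>$3
      else if k = 3 then - (\<kappa>$1 * \<kappa>$2 * \<kappa>$3)
      else 0)"

primrec newton ::
  "(real^3 \<Rightarrow> real^4) \<Rightarrow> (real^3 \<Rightarrow> real^4) \<Rightarrow> real^3 \<Rightarrow> nat \<Rightarrow> real^3^3"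
  where
    "newton X N p 0 = mat 1"
  | "newton X N p (Suc k) = mat (curv_coeff X N p (Suc k)) + shape X N p ** newton X N p k"

definition christoffel :: "(real^3 \<Rightarrow> real^4) \<Rightarrow> real^3 \<Rightarrow> 3 \<Rightarrow> 3 \<Rightarrow> 3 \<Rightarrow> real"
  where "christoffel X p i j l =
    1 / 2 * (\<Sum>r\<in>UNIV. inv_metric X p $ i $ r *
      (pd j (\<lambda>q. metric X q $ r $ l) p + pd l (\<lambda>q. metric X q $ r $ j) p
        - pd r (\<lambda>q. metric X q $ j $ l) p))"

definition grad :: "(real^3 \<Rightarrow> real^4) \<Rightarrow> (real^3 \<Rightarrow> real) \<Rightarrow> real^3 \<Rightarrow> real^3"
  where "grad X \<phi> p = (\<chi> i. \<Sum>r\<in>UNIV. inv_metric X p $ i $ r * pd r \<phi> p)"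

text \<open>
  The Hessian operator sends a tangent vector \<open>V\<close> to the Levi-Civita covariant derivative of the
  gradient of \<open>\<phi>\<close> in the direction \<open>V\<close>.
\<close>

definition hess_op :: "(real^3 \<Rightarrow> real^4) \<Rightarrow> (real^3 \<Rightarrow> real) \<Rightarrow> real^3 \<Rightarrow> real^3^3"
  where "hess_op X \<phi> p =
    (\<chi> i j. pd j (\<lambda>q. grad X \<phi> q $ i) p
      + (\<Sum>l\<in>UNIV. christoffel X p i j l * grad X \<phi> p $ l))"

definition L_op ::
  "nat \<Rightarrow> (real^3 \<Rightarrow> real^4) \<Rightarrow> (real^3 \<Rightarrow> real^4) \<Rightarrow> (real^3 \<Rightarrow> real) \<Rightarrow> real^3 \<Rightarrow> real"
  where "L_op k X N \<phi> p = trace (newton X N p k ** hess_op X \<phi> p)"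

definition L_op_vec ::
  "nat \<Rightarrow> (real^3 \<Rightarrow> real^4) \<Rightarrow> (real^3 \<Rightarrow> real^4) \<Rightarrow> (real^3 \<Rightarrow> real^4) \<Rightarrow> real^3 \<Rightarrow> real^4"
  where "L_op_vec k X N F p = (\<chi> a. L_op k X N (\<lambda>q. F q $ a) p)"

text \<open>
  The hypersurface is the point set \<open>X ` U\<close>, and \<open>m\<close> is a function on it (so it takes the same
  value at all parameters of one point); it is smooth when \<open>m \<circ> X\<close> is, \<open>X\<close> being a local
  parametrization near every point of \<open>U\<close>. The parametrization need not be injective, but the
  definition is meant for an embedded image.
\<close>

definition first_kind_L_pointwise_1_type_gauss_map ::
  "nat \<Rightarrow> (real^3 \<Rightarrow> real^4) \<Rightarrow> (real^3 \<Rightarrow> real^4) \<Rightarrow> (real^3) set \<Rightarrow> bool"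
  where "first_kind_L_pointwise_1_type_gauss_map k X N U \<longleftrightarrow>
    oriented_hypersurface X N U \<and>
    (\<exists>m :: real^4 \<Rightarrow> real.
      smooth_on U (m \<circ> X) \<and> (\<exists>q\<in>X ` U. m q \<noteq> 0) \<and>
      (\<forall>p\<in>U. L_op_vec k X N N p = m (X p) *\<^sub>R N p))"

section \<open>The rotational hypersurface\<close>

lemma vector_4:
  "(vector [w, x, y, z] :: 'a::zero^4) $ 1 = w"
  "(vector [w, x, y, z] :: 'a::zero^4) $ 2 = x"
  "(vector [w, x, y, z] :: 'a::zero^4) $ 3 = y"
  "(vector [w, x, y, z] :: 'a::zero^4) $ 4 = z"
  unfolding vector_def by simp_all

text \<open>The parameters \<open>(s, t, w)\<close> are the components \<open>(p$1, p$2, p$3)\<close> of \<open>p\<close>.\<close>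

definition rot_hypersurface :: "(real \<Rightarrow> real) \<Rightarrow> real^3 \<Rightarrow> real^4"
  where "rot_hypersurface f p =
    vector [f (p$1),
            - p$1 * cos (p$2) * sin (p$3),
            - p$1 * sin (p$2),
            p$1 * cos (p$2) * cos (p$3)]"

definition rot_gauss_map :: "(real \<Rightarrow> real) \<Rightarrow> real^3 \<Rightarrow> real^4"
  where "rot_gauss_map f p =
    (1 / sqrt ((deriv f (p$1))\<^sup>2 - 1)) *\<^sub>R
    vector [1,
            - deriv f (p$1) * cos (p$2) * sin (p$3),
            - deriv f (p$1) * sin (p$2),
            deriv f (p$1) * cos (p$2) * cos (p$3)]"

text \<open>
  The angles \<open>t\<close> and \<open>w\<close> range over all reals, which makes the domain open. Both maps above have
  period \<open>2\<pi>\<close> in each angle, so the hypersurface is the same point set as for angles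
  in \<open>[0, 2\<pi>]\<close>. The points where \<open>cos t = 0\<close>, at which the parametrization is not an immersion,
  are removed.
\<close>

definition rot_domain :: "real set \<Rightarrow> (real^3) set"
  where "rot_domain I = {p. p$1 \<in> I \<and> cos (p$2) \<noteq> 0}"

end

theory Submission
  imports Defs
begin

text \<open>
  With \<open>W = f'\<^sup>2 - 1\<close> and \<open>\<nu> = 1 / sqrt W\<close> the shape operator is diagonal in the coordinates
  \<open>(s, t, w)\<close>, with entries \<open>k1 = f'' \<nu>\<^sup>3\<close> and twice \<open>k2 = - f' \<nu> / s\<close>. Since
  \<open>k2' = (k1 - k2) / s\<close>, the differential equation says precisely that the Gauss-Kronecker
  curvature \<open>k1 k2\<^sup>2\<close> is constant, so that the gradient term in \<open>L\<^sub>2 N\<close> disappears and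
  \<open>L\<^sub>2 N = - k1 k2\<^sup>2 (k1 + 2 k2) N\<close>. If the factor vanished on all of \<open>I\<close>, then \<open>k1 = - 2 k2\<close>,
  which contradicts the two equations for \<open>k1'\<close> and \<open>k2'\<close>. The factor depends on \<open>s\<close> only, and
  \<open>s\<close> is, up to a sign that is constant on \<open>I\<close>, the Euclidean norm of the last three coordinates;
  hence it is a function on the point set.
\<close>

section \<open>Smooth functions\<close>

lemma partial_deriv_eqI:
  assumes "((\<lambda>h. \<phi> (p + h *\<^sub>R b)) has_vector_derivative d) (at 0)"
  shows "partial_deriv b \<phi> p = d"
  unfolding partial_deriv_def by (rule vector_derivative_at[OF assms])

lemma partial_deriv_has_derivative:
  assumes "(\<phi> has_derivative D) (at p)"
  shows "partial_deriv b \<phi> p = D b"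
proof (rule partial_deriv_eqI)
  have *: "((\<lambda>h. p + h *\<^sub>R b) has_derivative (\<lambda>h. h *\<^sub>R b)) (at (0::real))"
    by (auto intro!: derivative_eq_intros)
  have "((\<lambda>h. \<phi> (p + h *\<^sub>R b)) has_derivative (\<lambda>h. D (h *\<^sub>R b))) (at 0)"
    using has_derivative_compose[OF *] assms by simp
  then show "((\<lambda>h. \<phi> (p + h *\<^sub>R b)) has_vector_derivative D b) (at 0)"
    using has_derivative_linear[OF assms]
    by (simp add: has_vector_derivative_def linear_cmul)
qed

text \<open>For small \<open>h\<close> the point \<open>p + h *\<^sub>R b\<close> stays in the open
  set \<open>U\<close>, so both derivatives are taken of functions of \<open>h\<close> that agree
  near 0.\<close>

lemma partial_deriv_cong:
  assumes "open U" and "p \<in> U" and "\<And>q. q \<in> U \<Longrightarrow> \<phi> q = \<psi> q"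
  shows "partial_deriv b \<phi> p = partial_deriv b \<psi> p"
proof -
  have "((\<lambda>h. p + h *\<^sub>R b) \<longlongrightarrow> p + 0 *\<^sub>R b) (nhds (0::real))"
    by (intro tendsto_intros filterlim_ident)
  then have "\<forall>\<^sub>F h in nhds (0::real). p + h *\<^sub>R b \<in> U"
    using assms(1,2) by (auto dest: topological_tendstoD)
  then have "\<forall>\<^sub>F h in nhds (0::real). \<phi> (p + h *\<^sub>R b) = \<psi> (p + h *\<^sub>R b)"
    by eventually_elim (use assms(3) in auto)
  then show ?thesis
    unfolding partial_deriv_def by (intro vector_derivative_cong_eq) (auto simp: eventually_nhds)
qed

lemma differentiable_cong_open:
  assumes "open U" and "p \<in> U" and "\<And>q. q \<in> U \<Longrightarrow> \<phi> q = \<psi> q" and "\<psi> differentiable (at p)"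
  shows "\<phi> differentiable (at p)"
  using assms unfolding differentiable_def
  by (metis has_derivative_transform_within_open)

text \<open>Smooth functions form the largest class of functions differentiable on \<open>U\<close>
  and closed under partial derivatives, so one such class containing \<open>\<phi>\<close> is
  enough. Closure up to agreement on \<open>U\<close> suffices, because \<open>U\<close> is open and
  derivatives at its points see only values in \<open>U\<close>.\<close>

lemma smooth_on_coinduct:
  assumes "open U" and "C \<phi>"
    and diff: "\<And>\<psi> p. C \<psi> \<Longrightarrow> p \<in> U \<Longrightarrow> \<psi> differentiable (at p)"
    and step: "\<And>\<psi> b. C \<psi> \<Longrightarrow> b \<in> Basis \<Longrightarrow> \<exists>\<xi>. C \<xi> \<and> (\<forall>p\<in>U. partial_deriv b \<psi> p = \<xi> p)"
  shows "smooth_on U \<phi>"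
proof -
  have *: "\<exists>\<xi>. C \<xi> \<and> (\<forall>p\<in>U. foldr partial_deriv bs \<phi> p = \<xi> p)" if "set bs \<subseteq> Basis" for bs
    using that
  proof (induction bs)
    case Nil
    show ?case using assms(2) by auto
  next
    case (Cons b bs)
    then obtain \<xi> where \<xi>: "C \<xi>" "\<forall>p\<in>U. foldr partial_deriv bs \<phi> p = \<xi> p" by auto
    obtain \<xi>' where \<xi>': "C \<xi>'" "\<forall>p\<in>U. partial_deriv b \<xi> p = \<xi>' p"
      using step[OF \<xi>(1)] Cons.prems by (metis list.set_intros(1) subsetD)
    have "partial_deriv b (foldr partial_deriv bs \<phi>) p = partial_deriv b \<xi> p" if "p \<in> U" for p
      using partial_deriv_cong[OF assms(1) that] \<xi>(2) by blast
    then show ?case using \<xi>' by auto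
  qed
  show ?thesis
    unfolding smooth_on_def
    using * diff differentiable_cong_open[OF assms(1)] by metis
qed

lemma smooth_on_differentiable: "smooth_on U \<phi> \<Longrightarrow> p \<in> U \<Longrightarrow> \<phi> differentiable (at p)"
  unfolding smooth_on_def by (metis empty_subsetI foldr.simps(1) id_apply list.set(1))

lemma smooth_on_partial_deriv:
  assumes "smooth_on U \<phi>" and "b \<in> Basis"
  shows "smooth_on U (partial_deriv b \<phi>)"
  unfolding smooth_on_def
proof safe
  fix bs :: "'a list" and p assume "set bs \<subseteq> Basis" "p \<in> U"
  \<comment> \<open>\<open>foldr\<close> applies the last entry of the list first, so appending
    \<open>b\<close> differentiates along \<open>b\<close> before everything in
    \<open>bs\<close>.\<close>
  then have "foldr partial_deriv (bs @ [b]) \<phi> differentiable (at p)"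
    using assms unfolding smooth_on_def by (metis Un_insert_right empty_set insert_subset list.simps(15) set_append sup_bot.right_neutral)
  then show "foldr partial_deriv bs (partial_deriv b \<phi>) differentiable (at p)" by simp
qed

lemma smooth_on_cong:
  assumes "open U" and "smooth_on U \<psi>" and "\<And>q. q \<in> U \<Longrightarrow> \<phi> q = \<psi> q"
  shows "smooth_on U \<phi>"
proof (rule smooth_on_coinduct[where C = "\<lambda>\<phi>. \<exists>\<psi>. smooth_on U \<psi> \<and> (\<forall>q\<in>U. \<phi> q = \<psi> q)"])
  show "\<exists>\<psi>. smooth_on U \<psi> \<and> (\<forall>q\<in>U. \<phi> q = \<psi> q)" using assms by auto
next
  fix \<xi> p assume "\<exists>\<psi>. smooth_on U \<psi> \<and> (\<forall>q\<in>U. \<xi> q = \<psi> q)" "p \<in> U"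
  then show "\<xi> differentiable (at p)"
    using differentiable_cong_open[OF assms(1)] smooth_on_differentiable by metis
next
  fix \<xi> and b :: 'a assume "\<exists>\<psi>. smooth_on U \<psi> \<and> (\<forall>q\<in>U. \<xi> q = \<psi> q)" "b \<in> Basis"
  then show "\<exists>\<xi>'. (\<exists>\<psi>. smooth_on U \<psi> \<and> (\<forall>q\<in>U. \<xi>' q = \<psi> q)) \<and> (\<forall>p\<in>U. partial_deriv b \<xi> p = \<xi>' p)"
    using partial_deriv_cong[OF assms(1)] smooth_on_partial_deriv by metis
qed (rule assms(1))

text \<open>
  If the partial derivatives of all generators in \<open>G\<close> lie in the algebra generated by \<open>G\<close> and the
  smooth functions, then \<open>G\<close> consists of smooth functions. This covers \<open>sin\<close> and \<open>cos\<close>, \<open>inverse\<close>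
  and the \<open>\<nu>\<close> below, without a chain rule for iterated derivatives.
\<close>

inductive smooth_alg :: "'a::euclidean_space set \<Rightarrow> ('a \<Rightarrow> real) set \<Rightarrow> ('a \<Rightarrow> real) \<Rightarrow> bool"
  for U G where
  smooth: "smooth_on U \<phi> \<Longrightarrow> smooth_alg U G \<phi>"
| gen: "\<phi> \<in> G \<Longrightarrow> smooth_alg U G \<phi>"
| add: "smooth_alg U G \<phi> \<Longrightarrow> smooth_alg U G \<psi> \<Longrightarrow> smooth_alg U G (\<lambda>p. \<phi> p + \<psi> p)"
| mult: "smooth_alg U G \<phi> \<Longrightarrow> smooth_alg U G \<psi> \<Longrightarrow> smooth_alg U G (\<lambda>p. \<phi> p * \<psi> p)"

lemma partial_deriv_add:
  assumes "\<phi> differentiable (at p)" "\<psi> differentiable (at p)"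
  shows "partial_deriv b (\<lambda>q. \<phi> q + \<psi> q) p = partial_deriv b \<phi> p + partial_deriv b \<psi> p"
proof -
  obtain D E where D: "(\<phi> has_derivative D) (at p)" and E: "(\<psi> has_derivative E) (at p)"
    using assms unfolding differentiable_def by blast
  show ?thesis
    using partial_deriv_has_derivative[OF has_derivative_add[OF D E]]
      partial_deriv_has_derivative[OF D] partial_deriv_has_derivative[OF E] by simp
qed

lemma partial_deriv_mult:
  fixes \<phi> \<psi> :: "'a::euclidean_space \<Rightarrow> real"
  assumes "\<phi> differentiable (at p)" "\<psi> differentiable (at p)"
  shows "partial_deriv b (\<lambda>q. \<phi> q * \<psi> q) p = \<phi> p * partial_deriv b \<psi> p + partial_deriv b \<phi> p * \<psi> p"
proof -
  obtain D E where D: "(\<phi> has_derivative D) (at p)" and E: "(\<psi> has_derivative E) (at p)"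
    using assms unfolding differentiable_def by blast
  show ?thesis
    using partial_deriv_has_derivative[OF has_derivative_mult[OF D E]]
      partial_deriv_has_derivative[OF D] partial_deriv_has_derivative[OF E] by simp
qed

text \<open>The sum and product rules keep partial derivatives inside the algebra, so the algebra
  itself serves as the class for the coinduction.\<close>

lemma smooth_alg_smooth_on:
  assumes "open U" and "smooth_alg U G \<phi>"
    and diff: "\<And>g p. g \<in> G \<Longrightarrow> p \<in> U \<Longrightarrow> g differentiable (at p)"
    and step: "\<And>g b. g \<in> G \<Longrightarrow> b \<in> Basis \<Longrightarrow>
      \<exists>\<xi>. smooth_alg U G \<xi> \<and> (\<forall>p\<in>U. partial_deriv b g p = \<xi> p)"
  shows "smooth_on U \<phi>"
proof (rule smooth_on_coinduct[where C = "smooth_alg U G"])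
  show d: "\<psi> differentiable (at p)" if "smooth_alg U G \<psi>" "p \<in> U" for \<psi> p
    using that by induction (auto intro: smooth_on_differentiable diff)
  show "\<exists>\<xi>. smooth_alg U G \<xi> \<and> (\<forall>p\<in>U. partial_deriv b \<psi> p = \<xi> p)"
    if "smooth_alg U G \<psi>" "b \<in> Basis" for \<psi> b
    using that
  proof induction
    case (smooth \<phi>)
    then show ?case by (auto intro: smooth_alg.smooth smooth_on_partial_deriv)
  next
    case (gen \<phi>)
    then show ?case using step by blast
  next
    case (add \<phi> \<psi>)
    then obtain \<xi> \<xi>' where "smooth_alg U G \<xi>" "\<forall>p\<in>U. partial_deriv b \<phi> p = \<xi> p"
      "smooth_alg U G \<xi>'" "\<forall>p\<in>U. partial_deriv b \<psi> p = \<xi>' p" by blast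
    then show ?case
      using partial_deriv_add[OF d d] add.hyps
      by (intro exI[of _ "\<lambda>p. \<xi> p + \<xi>' p"]) (auto intro: smooth_alg.add)
  next
    case (mult \<phi> \<psi>)
    then obtain \<xi> \<xi>' where "smooth_alg U G \<xi>" "\<forall>p\<in>U. partial_deriv b \<phi> p = \<xi> p"
      "smooth_alg U G \<xi>'" "\<forall>p\<in>U. partial_deriv b \<psi> p = \<xi>' p" by blast
    then show ?case
      using partial_deriv_mult[OF d d] mult.hyps
      by (intro exI[of _ "\<lambda>p. \<phi> p * \<xi>' p + \<xi> p * \<psi> p"])
        (auto intro: smooth_alg.add smooth_alg.mult)
  qed
qed (fact assms)+

section \<open>Closure properties and elementary smooth functions\<close>

lemma smooth_on_add:
  fixes \<phi> \<psi> :: "'a::euclidean_space \<Rightarrow> real"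
  shows "open U \<Longrightarrow> smooth_on U \<phi> \<Longrightarrow> smooth_on U \<psi> \<Longrightarrow> smooth_on U (\<lambda>p. \<phi> p + \<psi> p)"
  \<comment> \<open>Without generators the algebra consists of the sums and products formed from
    smooth functions.\<close>
  by (rule smooth_alg_smooth_on[where G = "{}"]) (auto intro: smooth_alg.intros)

lemma smooth_on_mult:
  fixes \<phi> \<psi> :: "'a::euclidean_space \<Rightarrow> real"
  shows "open U \<Longrightarrow> smooth_on U \<phi> \<Longrightarrow> smooth_on U \<psi> \<Longrightarrow> smooth_on U (\<lambda>p. \<phi> p * \<psi> p)"
  by (rule smooth_alg_smooth_on[where G = "{}"]) (auto intro: smooth_alg.intros)

lemma smooth_on_const: "open U \<Longrightarrow> smooth_on U (\<lambda>_. c)"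
  by (rule smooth_on_coinduct[where C = "\<lambda>\<phi>. \<exists>c. \<phi> = (\<lambda>_. c)"])
    (auto simp: partial_deriv_has_derivative[OF has_derivative_const])

lemma smooth_on_minus:
  fixes \<phi> :: "'a::euclidean_space \<Rightarrow> real"
  shows "open U \<Longrightarrow> smooth_on U \<phi> \<Longrightarrow> smooth_on U (\<lambda>p. - \<phi> p)"
  using smooth_on_mult[of U "\<lambda>_. -1" \<phi>] by (simp add: smooth_on_const)

lemma smooth_on_power:
  fixes \<phi> :: "'a::euclidean_space \<Rightarrow> real"
  shows "open U \<Longrightarrow> smooth_on U \<phi> \<Longrightarrow> smooth_on U (\<lambda>p. \<phi> p ^ n)"
  by (induction n) (auto intro: smooth_on_mult smooth_on_const)

lemma partial_deriv_real:
  fixes g :: "real \<Rightarrow> real"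
  assumes "(g has_real_derivative d) (at x)"
  shows "partial_deriv 1 g x = d"
  using partial_deriv_has_derivative[OF assms[unfolded has_field_derivative_def]] by simp

lemma smooth_on_real_algI:
  fixes g :: "real \<Rightarrow> real"
  assumes "open U" and "g \<in> G"
    and "\<And>h. h \<in> G \<Longrightarrow>
      \<exists>\<xi>. smooth_alg U G \<xi> \<and> (\<forall>x\<in>U. (h has_real_derivative \<xi> x) (at x))"
  shows "smooth_on U g"
proof (rule smooth_alg_smooth_on[where G = G])
  show "smooth_alg U G g" using assms(2) by (rule smooth_alg.gen)
  show "h differentiable (at x)" if "h \<in> G" "x \<in> U" for h x
    using assms(3)[OF that(1)] that(2) real_differentiable_def by blast
  show "\<exists>\<xi>. smooth_alg U G \<xi> \<and> (\<forall>p\<in>U. partial_deriv b h p = \<xi> p)"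
    if "h \<in> G" "b \<in> Basis" for h b
    using assms(3)[OF that(1)] that(2) partial_deriv_real by auto
qed (rule assms(1))

lemma smooth_on_sin_cos:
  assumes "open U"
  shows "smooth_on U (sin :: real \<Rightarrow> real)" and "smooth_on U (cos :: real \<Rightarrow> real)"
proof -
  have *: "\<exists>\<xi>. smooth_alg U {sin, cos} \<xi> \<and> (\<forall>x\<in>U. (h has_real_derivative \<xi> x) (at x))"
    if "h \<in> {sin, cos}" for h :: "real \<Rightarrow> real"
  proof (cases "h = sin")
    case True
    then show ?thesis by (intro exI[of _ cos]) (auto intro: smooth_alg.gen)
  next
    case False
    then have h: "h = cos" using that by simp
    \<comment> \<open>The algebra has no clause for negation; the sign enters as multiplication by a
      constant smooth function.\<close>
    have "smooth_alg U {sin, cos} (\<lambda>x. -1 * sin x)"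
      by (intro smooth_alg.mult smooth_alg.smooth smooth_on_const assms smooth_alg.gen) auto
    then show ?thesis unfolding h
      by (intro exI[of _ "\<lambda>x. -1 * sin x"]) (auto intro!: derivative_eq_intros)
  qed
  show "smooth_on U (sin :: real \<Rightarrow> real)" "smooth_on U (cos :: real \<Rightarrow> real)"
    by (rule smooth_on_real_algI[OF assms _ *]; simp)+
qed

lemma smooth_on_ident:
  assumes "open U" shows "smooth_on U (\<lambda>x::real. x)"
  by (rule smooth_on_real_algI[where G = "{\<lambda>x. x}"])
    (auto intro!: assms exI[of _ "\<lambda>_. 1"] smooth_alg.smooth smooth_on_const)

text \<open>The derivative of \<open>inverse\<close> is minus its own square, a polynomial in the
  single generator.\<close>

lemma smooth_on_inverse:
  fixes U :: "real set"
  assumes "open U" and "0 \<notin> U" shows "smooth_on U inverse"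
proof (rule smooth_on_real_algI[where G = "{inverse}"])
  fix h :: "real \<Rightarrow> real" assume h: "h \<in> {inverse}"
  have "smooth_alg U {inverse} (\<lambda>x. -1 * (inverse x * inverse x))"
    by (intro smooth_alg.mult smooth_alg.smooth smooth_on_const assms smooth_alg.gen) auto
  then show "\<exists>\<xi>. smooth_alg U {inverse} \<xi> \<and> (\<forall>x\<in>U. (h has_real_derivative \<xi> x) (at x))"
    using h assms(2)
    by (intro exI[of _ "\<lambda>x. -1 * (inverse x * inverse x)"])
      (auto intro!: derivative_eq_intros)
qed (use assms in auto)

lemma smooth_on_DERIV:
  fixes g :: "real \<Rightarrow> real"
  assumes "smooth_on U g" and "x \<in> U"
  shows "(g has_real_derivative deriv g x) (at x)"
  using smooth_on_differentiable[OF assms] DERIV_deriv_iff_real_differentiable by blast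

lemma smooth_on_deriv:
  fixes g :: "real \<Rightarrow> real"
  assumes "open U" and "smooth_on U g"
  shows "smooth_on U (deriv g)"
  by (rule smooth_on_cong[OF assms(1) smooth_on_partial_deriv[OF assms(2), of 1]])
    (simp_all add: partial_deriv_real[OF smooth_on_DERIV[OF assms(2)]])

text \<open>Differentiating along \<open>b\<close> replaces \<open>F\<close> by its derivative and
  multiplies by the number \<open>b $ i\<close>. The constant factor \<open>c\<close> in the
  coinduction class absorbs that number.\<close>

lemma smooth_on_compose_nth:
  fixes F :: "real \<Rightarrow> real" and i :: "'n::finite"
  assumes "open U" and "smooth_on J F" and "\<And>p. p \<in> U \<Longrightarrow> p $ i \<in> J"
  shows "smooth_on U (\<lambda>p::real^'n. F (p $ i))"
proof (rule smooth_on_coinduct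
    [where C = "\<lambda>\<phi>. \<exists>c F. smooth_on J F \<and> \<phi> = (\<lambda>p. c * F (p $ i))"])
  have hd: "((\<lambda>p::real^'n. c * F (p $ i)) has_derivative (\<lambda>v. c * (partial_deriv 1 F (p $ i) * v $ i))) (at p)"
    if F: "smooth_on J F" and "p \<in> U" for c F p
  proof -
    have "(F has_real_derivative deriv F (p $ i)) (at (p $ i))"
      by (rule smooth_on_DERIV[OF F assms(3)[OF that(2)]])
    \<comment> \<open>The derivative is written as \<open>partial_deriv 1 F\<close>, whose
      smoothness on \<open>J\<close> follows from that of \<open>F\<close>; for
      \<open>deriv F\<close> the corresponding lemma asks for an open set, and \<open>J\<close> is
      arbitrary.\<close>
    then have "(F has_derivative (\<lambda>x. partial_deriv 1 F (p $ i) * x)) (at (p $ i))"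
      using partial_deriv_real by (simp add: has_field_derivative_def)
    from has_derivative_compose[OF bounded_linear_imp_has_derivative[OF bounded_linear_vec_nth] this]
    show ?thesis by (rule has_derivative_mult_right)
  qed
  show "\<exists>c F'. smooth_on J F' \<and> (\<lambda>p::real^'n. F (p $ i)) = (\<lambda>p. c * F' (p $ i))"
    using assms(2) by (intro exI[of _ 1] exI[of _ F]) auto
  show "\<psi> differentiable (at p)"
    if "\<exists>c F. smooth_on J F \<and> \<psi> = (\<lambda>p. c * F (p $ i))" "p \<in> U" for \<psi> :: "real^'n \<Rightarrow> real" and p
    using that hd unfolding differentiable_def by blast
  show "\<exists>\<xi>. (\<exists>c F. smooth_on J F \<and> \<xi> = (\<lambda>p. c * F (p $ i))) \<and> (\<forall>p\<in>U. partial_deriv b \<psi> p = \<xi> p)"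
    if \<psi>: "\<exists>c F. smooth_on J F \<and> \<psi> = (\<lambda>p. c * F (p $ i))" for \<psi> :: "real^'n \<Rightarrow> real" and b
  proof -
    obtain c F where F: "smooth_on J F" and \<psi>: "\<psi> = (\<lambda>p. c * F (p $ i))" using \<psi> by blast
    have "smooth_on J (partial_deriv 1 F)" using F by (rule smooth_on_partial_deriv) simp
    moreover have "\<forall>p\<in>U. partial_deriv b \<psi> p = (c * b $ i) * partial_deriv 1 F (p $ i)"
      unfolding \<psi> using partial_deriv_has_derivative[OF hd[OF F]] by simp
    ultimately show ?thesis by blast
  qed
qed (rule assms(1))

lemma partial_deriv_nth:
  fixes \<phi> :: "'a::euclidean_space \<Rightarrow> real^'n"
  assumes "\<And>i. (\<lambda>q. \<phi> q $ i) differentiable (at p)"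
  shows "\<phi> differentiable (at p)" and "partial_deriv b \<phi> p $ i = partial_deriv b (\<lambda>q. \<phi> q $ i) p"
proof -
  obtain D where D: "\<And>i. ((\<lambda>q. \<phi> q $ i) has_derivative D i) (at p)"
    using assms unfolding differentiable_def by metis
  have *: "(\<phi> has_derivative (\<lambda>v. \<chi> i. D i v)) (at p)"
    by (subst has_derivative_componentwise_within)
      (auto simp: Basis_vec_def inner_axis intro: D)
  then show "\<phi> differentiable (at p)" unfolding differentiable_def by blast
  show "partial_deriv b \<phi> p $ i = partial_deriv b (\<lambda>q. \<phi> q $ i) p"
    using partial_deriv_has_derivative[OF *] partial_deriv_has_derivative[OF D] by simp
qed

lemma smooth_on_vec:
  fixes \<phi> :: "'a::euclidean_space \<Rightarrow> real^'n"
  assumes "open U" and "\<And>i. smooth_on U (\<lambda>q. \<phi> q $ i)"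
  shows "smooth_on U \<phi>"
proof (rule smooth_on_coinduct[where C = "\<lambda>\<phi>. \<forall>i. smooth_on U (\<lambda>q. \<phi> q $ i)"])
  show "\<psi> differentiable (at p)" if "\<forall>i. smooth_on U (\<lambda>q. \<psi> q $ i)" "p \<in> U" for \<psi> :: "'a \<Rightarrow> real^'n" and p
    using that by (auto intro: partial_deriv_nth smooth_on_differentiable)
  show "\<exists>\<xi>. (\<forall>i. smooth_on U (\<lambda>q. \<xi> q $ i)) \<and> (\<forall>p\<in>U. partial_deriv b \<psi> p = \<xi> p)"
    if "\<forall>i. smooth_on U (\<lambda>q. \<psi> q $ i)" "b \<in> Basis" for \<psi> :: "'a \<Rightarrow> real^'n" and b
    using that
    by (intro exI[of _ "\<lambda>p. \<chi> i. partial_deriv b (\<lambda>q. \<psi> q $ i) p"])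
      (auto simp: vec_eq_iff intro!: smooth_on_partial_deriv partial_deriv_nth(2)
        intro: smooth_on_differentiable)
qed (use assms in auto)

section \<open>Orthogonal principal coordinates\<close>

definition diag_mat :: "('n \<Rightarrow> real) \<Rightarrow> real^'n^'n"
  where "diag_mat d = (\<chi> i j. if i = j then d i else 0)"

lemma diag_mat_nth: "diag_mat d $ i $ j = (if i = j then d i else 0)"
  by (simp add: diag_mat_def)

lemma diag_mat_mult: "diag_mat d ** diag_mat e = diag_mat (\<lambda>i. d i * e i)"
  by (simp add: matrix_matrix_mult_def diag_mat_def vec_eq_iff
      if_distrib[of "\<lambda>x. x * _"] if_distrib[of "\<lambda>x. _ * x"] cong: if_cong)

lemma mat_eq_diag_mat: "mat c = diag_mat (\<lambda>_. c)"
  by (simp add: mat_def diag_mat_def)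

lemma diag_mat_add: "diag_mat d + diag_mat e = diag_mat (\<lambda>i. d i + e i)"
  by (simp add: diag_mat_def vec_eq_iff)

lemma
  assumes "\<And>i. d i \<noteq> 0"
  shows invertible_diag_mat: "invertible (diag_mat d)"
    and matrix_inv_diag_mat: "matrix_inv (diag_mat d) = diag_mat (\<lambda>i. 1 / d i)"
proof -
  have 1: "diag_mat d ** diag_mat (\<lambda>i. 1 / d i) = mat 1" "diag_mat (\<lambda>i. 1 / d i) ** diag_mat d = mat 1"
    using assms by (simp_all add: diag_mat_mult mat_eq_diag_mat)
  then show "invertible (diag_mat d)" unfolding invertible_def by blast
  \<comment> \<open>\<open>matrix_inv\<close> is a choice of two-sided inverse; multiplication from
    the left by the explicit inverse identifies it.\<close>
  have "diag_mat d ** matrix_inv (diag_mat d) = mat 1"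
    unfolding matrix_inv_def using someI[of "\<lambda>B. diag_mat d ** B = mat 1 \<and> B ** diag_mat d = mat 1"] 1
    by blast
  then have "diag_mat (\<lambda>i. 1 / d i) ** (diag_mat d ** matrix_inv (diag_mat d)) = diag_mat (\<lambda>i. 1 / d i)"
    by simp
  then show "matrix_inv (diag_mat d) = diag_mat (\<lambda>i. 1 / d i)"
    unfolding matrix_mul_assoc 1(2) by simp
qed

lemma trace_diag_mat_mult:
  "trace (diag_mat d ** A) = (\<Sum>i\<in>UNIV. d i * A $ i $ i)"
  by (simp add: trace_def matrix_matrix_mult_def diag_mat_def if_distrib[of "\<lambda>x. x * _"] cong: if_cong)

section \<open>Shape operator, curvatures and Hessian in orthogonal principal coordinates\<close>

lemma monic_cubic_roots_symmetric:
  fixes a b c x y z :: real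
  assumes "\<And>t. (t - a) * (t - b) * (t - c) = (t - x) * (t - y) * (t - z)"
  shows "a + b + c = x + y + z" and "a * b + a * c + b * c = x * y + x * z + y * z"
    and "a * b * c = x * y * z"
proof -
  show "a * b * c = x * y * z" using assms[of 0] by simp
  \<comment> \<open>The sum of the values at 1 and -1 yields the first symmetric function, their
    difference the second.\<close>
  then show "a + b + c = x + y + z" "a * b + a * c + b * c = x * y + x * z + y * z"
    using assms[of 1] assms[of "-1"] by (simp_all add: algebra_simps)
qed

text \<open>Pairing a vanishing combination with each frame vector puts its coefficients into the
  kernel of the Gram matrix \<open>metric X p\<close>. Nondegeneracy of the metric therefore makes
  the frame linearly independent.\<close>

lemma linear_combination_tangent:
  assumes "invertible (metric X p)" and "(\<Sum>i\<in>UNIV. c i *\<^sub>R pd i X p) = 0"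
  shows "c i = 0"
proof -
  have lor: "lorentz (pd j X p) (\<Sum>i\<in>UNIV. c i *\<^sub>R pd i X p) =
      (\<Sum>i\<in>UNIV. metric X p $ j $ i * c i)" for j
    by (simp add: metric_def lorentz_def sum_3 algebra_simps)
  have "metric X p *v (\<chi> i. c i) = 0"
    using lor assms(2) by (simp add: matrix_vector_mult_def vec_eq_iff lorentz_def)
  then have "(\<chi> i. c i) = (0 :: real^3)"
    using assms(1) by (metis inj_matrix_vector_mult injD matrix_vector_mult_0_right)
  then show ?thesis by (simp add: vec_eq_iff)
qed

text \<open>\<open>shape\<close> is a definite description, so an exhibited matrix identifies it
  only together with uniqueness, which comes from the linear independence of the frame.\<close>

lemma shape_eq_diag_mat:
  assumes "invertible (metric X p)" and "\<And>j. - pd j N p = \<kappa> j *\<^sub>R pd j X p"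
  shows "shape X N p = diag_mat \<kappa>"
  unfolding shape_def
proof (rule the_equality)
  show diag: "\<forall>j. - pd j N p = (\<Sum>i\<in>UNIV. diag_mat \<kappa> $ i $ j *\<^sub>R pd i X p)"
    using assms(2) by (simp add: diag_mat_nth if_distrib[of "\<lambda>c. c *\<^sub>R _"] cong: if_cong)
  fix A :: "real^3^3"
  assume A: "\<forall>j. - pd j N p = (\<Sum>i\<in>UNIV. A $ i $ j *\<^sub>R pd i X p)"
  have "A $ i $ j - diag_mat \<kappa> $ i $ j = 0" for i j
  proof (rule linear_combination_tangent[OF assms(1), where c = "\<lambda>i. A $ i $ j - diag_mat \<kappa> $ i $ j"])
    show "(\<Sum>i\<in>UNIV. (A $ i $ j - diag_mat \<kappa> $ i $ j) *\<^sub>R pd i X p) = 0"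
      using A[rule_format, of j] diag[rule_format, of j]
      by (simp add: scaleR_left_diff_distrib sum_subtractf)
  qed
  then show "A = diag_mat \<kappa>" by (simp add: vec_eq_iff)
qed

text \<open>The diagonal entries show that the characteristic polynomial splits, so the chosen
  \<open>principal_curvatures\<close> are its roots. Their order is unknown, but symmetric functions
  of them can be read off from the diagonal.\<close>

lemma curv_coeff_diag_mat:
  assumes "shape X N p = diag_mat \<kappa>"
  shows "curv_coeff X N p 1 = - (\<kappa> 1 + \<kappa> 2 + \<kappa> 3)"
    and "curv_coeff X N p 2 = \<kappa> 1 * \<kappa> 2 + \<kappa> 1 * \<kappa> 3 + \<kappa> 2 * \<kappa> 3"
proof -
  have det: "det (mat x - shape X N p) = (x - \<kappa> 1) * (x - \<kappa> 2) * (x - \<kappa> 3)" for x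
    by (simp add: assms det_3 mat_def diag_mat_nth)
  define k where "k = principal_curvatures X N p"
  have "\<forall>x. det (mat x - shape X N p) = (x - k$1) * (x - k$2) * (x - k$3)"
    unfolding k_def principal_curvatures_def
    by (rule someI[where x = "\<chi> i. \<kappa> i"]) (simp add: det)
  then have *: "(x - k$1) * (x - k$2) * (x - k$3) = (x - \<kappa> 1) * (x - \<kappa> 2) * (x - \<kappa> 3)" for x
    using det by simp
  show "curv_coeff X N p 1 = - (\<kappa> 1 + \<kappa> 2 + \<kappa> 3)"
    "curv_coeff X N p 2 = \<kappa> 1 * \<kappa> 2 + \<kappa> 1 * \<kappa> 3 + \<kappa> 2 * \<kappa> 3"
    using monic_cubic_roots_symmetric[OF *]
    by (simp_all add: curv_coeff_def k_def[symmetric])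
qed

text \<open>On the eigenvector with eigenvalue \<open>\<kappa> i\<close>, the inner factor (first
  coefficient plus shape operator) is minus the sum of the other two curvatures. Multiplying by
  \<open>\<kappa> i\<close> and adding the second coefficient leaves the product of those
  two.\<close>

lemma newton_2_diag_mat:
  assumes "shape X N p = diag_mat \<kappa>"
  shows "newton X N p 2 = diag_mat (\<lambda>i. if i = 1 then \<kappa> 2 * \<kappa> 3 else if i = 2 then \<kappa> 1 * \<kappa> 3 else \<kappa> 1 * \<kappa> 2)"
proof -
  have "newton X N p 2 = mat (curv_coeff X N p 2) + shape X N p ** (mat (curv_coeff X N p 1) + shape X N p)"
    by (simp add: eval_nat_numeral)
  also have "\<dots> = diag_mat (\<lambda>i. if i = 1 then \<kappa> 2 * \<kappa> 3 else if i = 2 then \<kappa> 1 * \<kappa> 3 else \<kappa> 1 * \<kappa> 2)"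
    unfolding curv_coeff_diag_mat[OF assms] assms mat_eq_diag_mat diag_mat_add diag_mat_mult
    by (simp add: vec_eq_iff diag_mat_nth forall_3 algebra_simps)
  finally show ?thesis .
qed

text \<open>The trace against a diagonal Newton transformation sees only these entries. In
  \<open>christoffel X p i i l\<close> two of the three metric derivatives cancel, which leaves half
  the logarithmic derivative of \<open>d i\<close> along coordinate \<open>l\<close>.\<close>

lemma hess_op_diagonal:
  assumes "open U" and "p \<in> U"
    and metric: "\<And>q. q \<in> U \<Longrightarrow> metric X q = diag_mat (\<lambda>i. d i q)"
    and nz: "\<And>q i. q \<in> U \<Longrightarrow> d i q \<noteq> 0"
  shows "hess_op X \<phi> p $ i $ i = pd i (\<lambda>q. pd i \<phi> q / d i q) p
    + (\<Sum>l\<in>UNIV. pd l (d i) p / (2 * d i p) * (pd l \<phi> p / d l p))"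
proof -
  have inv: "inv_metric X q = diag_mat (\<lambda>i. 1 / d i q)" if "q \<in> U" for q
    using metric[OF that] nz[OF that] by (simp add: inv_metric_def matrix_inv_diag_mat)
  have grad: "grad X \<phi> q $ i = pd i \<phi> q / d i q" if "q \<in> U" for q i
    by (simp add: grad_def inv[OF that] diag_mat_nth if_distrib[of "\<lambda>x. x * _"] cong: if_cong)
  have pdm: "pd k (\<lambda>q. metric X q $ r $ l) p = (if r = l then pd k (d r) p else 0)" for k r l
  proof -
    have "pd k (\<lambda>q. metric X q $ r $ l) p = pd k (\<lambda>q. if r = l then d r q else 0) p"
      by (rule partial_deriv_cong[OF assms(1,2)]) (simp add: metric diag_mat_nth)
    then show ?thesis
      by (cases "r = l") (auto simp: partial_deriv_has_derivative[OF has_derivative_const])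
  qed
  have chr: "christoffel X p i i l = pd l (d i) p / (2 * d i p)" for l
    unfolding christoffel_def inv[OF assms(2)]
    by (simp add: diag_mat_nth pdm if_distrib[of "\<lambda>x. x * _"] cong: if_cong)
  have "pd i (\<lambda>q. grad X \<phi> q $ i) p = pd i (\<lambda>q. pd i \<phi> q / d i q) p"
    by (rule partial_deriv_cong[OF assms(1,2)]) (simp add: grad)
  then show ?thesis
    by (simp add: hess_op_def chr grad[OF assms(2)])
qed

lemma L_op_2_diag_mat:
  assumes "shape X N p = diag_mat \<kappa>"
  shows "L_op 2 X N \<phi> p = \<kappa> 2 * \<kappa> 3 * hess_op X \<phi> p $ 1 $ 1
    + \<kappa> 1 * \<kappa> 3 * hess_op X \<phi> p $ 2 $ 2 + \<kappa> 1 * \<kappa> 2 * hess_op X \<phi> p $ 3 $ 3"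
  unfolding L_op_def newton_2_diag_mat[OF assms] trace_diag_mat_mult by (simp add: sum_3)

section \<open>The rotational hypersurface\<close>

lemma pd_separated:
  fixes a b c :: "real \<Rightarrow> real"
  shows "(a has_real_derivative a') (at (p$1)) \<Longrightarrow>
      pd 1 (\<lambda>q. a (q$1) * b (q$2) * c (q$3)) p = a' * b (p$2) * c (p$3)"
    and "(b has_real_derivative b') (at (p$2)) \<Longrightarrow>
      pd 2 (\<lambda>q. a (q$1) * b (q$2) * c (q$3)) p = a (p$1) * b' * c (p$3)"
    and "(c has_real_derivative c') (at (p$3)) \<Longrightarrow>
      pd 3 (\<lambda>q. a (q$1) * b (q$2) * c (q$3)) p = a (p$1) * b (p$2) * c'"
proof -
  have ax: "(axis i (1::real) :: real^3) $ j = (if i = j then 1 else 0)" for i j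
    by (simp add: axis_def)
  \<comment> \<open>\<open>partial_deriv\<close> differentiates in the increment \<open>h\<close> at
    0, while the factors are differentiated at the point itself.\<close>
  have sh: "((\<lambda>h. g (x + h)) has_real_derivative g') (at 0)"
    if "(g has_real_derivative g') (at x)" for g g' and x :: real
    using that DERIV_shift[of g g' 0 x] by (simp add: add.commute)
  show "pd 1 (\<lambda>q. a (q$1) * b (q$2) * c (q$3)) p = a' * b (p$2) * c (p$3)"
    if "(a has_real_derivative a') (at (p$1))"
    using sh[OF that]
    by (intro partial_deriv_eqI)
      (auto simp: ax has_real_derivative_iff_has_vector_derivative[symmetric] intro!: derivative_eq_intros)
  show "pd 2 (\<lambda>q. a (q$1) * b (q$2) * c (q$3)) p = a (p$1) * b' * c (p$3)"
    if "(b has_real_derivative b') (at (p$2))"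
    using sh[OF that]
    by (intro partial_deriv_eqI)
      (auto simp: ax has_real_derivative_iff_has_vector_derivative[symmetric] intro!: derivative_eq_intros)
  show "pd 3 (\<lambda>q. a (q$1) * b (q$2) * c (q$3)) p = a (p$1) * b (p$2) * c'"
    if "(c has_real_derivative c') (at (p$3))"
    using sh[OF that]
    by (intro partial_deriv_eqI)
      (auto simp: ax has_real_derivative_iff_has_vector_derivative[symmetric] intro!: derivative_eq_intros)
qed

text \<open>Component \<open>a\<close> of the hypersurface and of its Gauss map is a function of
  \<open>s\<close> times \<open>lat a t * lon a w\<close>. All signs sit in \<open>lat\<close>, and
  component 1 gets constant factors 1, so that all four components have one shape. The primed
  functions tabulate the derivatives.\<close>

definition lat :: "4 \<Rightarrow> real \<Rightarrow> real"
  where "lat a t = (vector [1, - cos t, - sin t, cos t] :: real^4) $ a"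

definition lat' :: "4 \<Rightarrow> real \<Rightarrow> real"
  where "lat' a t = (vector [0, sin t, - cos t, - sin t] :: real^4) $ a"

definition lat'' :: "4 \<Rightarrow> real \<Rightarrow> real"
  where "lat'' a t = (vector [0, cos t, sin t, - cos t] :: real^4) $ a"

definition lon :: "4 \<Rightarrow> real \<Rightarrow> real"
  where "lon a w = (vector [1, sin w, 1, cos w] :: real^4) $ a"

definition lon' :: "4 \<Rightarrow> real \<Rightarrow> real"
  where "lon' a w = (vector [0, cos w, 0, - sin w] :: real^4) $ a"

definition lon'' :: "4 \<Rightarrow> real \<Rightarrow> real"
  where "lon'' a w = (vector [0, - sin w, 0, - cos w] :: real^4) $ a"

lemmas ang_defs = lat_def lat'_def lat''_def lon_def lon'_def lon''_def

lemma ang_DERIV: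
  "(lat a has_real_derivative lat' a t) (at t)"
  "(lat' a has_real_derivative lat'' a t) (at t)"
  "(lon a has_real_derivative lon' a t) (at t)"
  "(lon' a has_real_derivative lon'' a t) (at t)"
  using exhaust_4[of a]
  by (auto simp: ang_defs[abs_def] vector_4 intro!: derivative_eq_intros)

lemma smooth_on_lat: "open U \<Longrightarrow> smooth_on U (lat a)"
  using exhaust_4[of a]
  by (auto simp: lat_def[abs_def] vector_4 intro!: smooth_on_const smooth_on_minus smooth_on_sin_cos)

lemma smooth_on_lon: "open U \<Longrightarrow> smooth_on U (lon a)"
  using exhaust_4[of a]
  by (auto simp: lon_def[abs_def] vector_4 intro!: smooth_on_const smooth_on_minus smooth_on_sin_cos)

text \<open>The coordinate functions of the unit sphere are eigenfunctions of its Laplacian.\<close>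

lemma sphere_laplacian:
  assumes "cos t \<noteq> 0" and "a \<noteq> 1"
  shows "lat'' a t * lon a w + lat a t * lon'' a w / (cos t)\<^sup>2 - sin t / cos t * (lat' a t * lon a w)
    = - 2 * (lat a t * lon a w)"
proof -
  have sc: "(cos t)\<^sup>2 = 1 - (sin t)\<^sup>2" by (simp add: cos_squared_eq)
  have "C + C / (cos t)\<^sup>2 - (sin t)\<^sup>2 / (cos t)\<^sup>2 * C = 2 * C" for C
    using assms(1) unfolding sc[symmetric] by (simp add: field_simps sin_squared_eq)
  from this[of "lat a t * lon a w"]
  show ?thesis
    using exhaust_4[of a] assms
    by (auto simp: ang_defs vector_4 power2_eq_square algebra_simps)
qed

lemma rot_hypersurface_nth:
  "rot_hypersurface f p $ a = (if a = 1 then f else (\<lambda>s. s)) (p$1) * lat a (p$2) * lon a (p$3)"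
  using exhaust_4[of a] by (auto simp: rot_hypersurface_def ang_defs vector_4)

section \<open>The profile function and the principal curvatures\<close>

locale profile =
  fixes f :: "real \<Rightarrow> real" and I :: "real set"
  assumes open_I: "open I" and interval_I: "is_interval I" and nonempty_I: "I \<noteq> {}" and zero_notin_I: "0 \<notin> I"
    and smooth_f: "smooth_on I f"
    and deriv_sq_gt_1: "\<And>s. s \<in> I \<Longrightarrow> (deriv f s)\<^sup>2 > 1"
    and deriv2_nonzero: "\<And>s. s \<in> I \<Longrightarrow> deriv (deriv f) s \<noteq> 0"
    and ode: "\<And>s. s \<in> I \<Longrightarrow>
      deriv (deriv (deriv f)) s / deriv (deriv f) s =
        (s * (3 * (deriv f s)\<^sup>2 + 2) * deriv (deriv f) s + 2 * deriv f s * ((deriv f s)\<^sup>2 - 1))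
        / (s * deriv f s * ((deriv f s)\<^sup>2 - 1))"
begin

definition "\<nu> s = 1 / sqrt ((deriv f s)\<^sup>2 - 1)"
definition "\<mu> s = deriv f s * \<nu> s"
definition "k1 s = deriv (deriv f) s * \<nu> s ^ 3"
definition "k2 s = - \<mu> s / s"
text \<open>This is the derivative of \<open>k1\<close> forced by constancy of
  \<open>k1 * k2\<^sup>2\<close> when \<open>k2\<close> has derivative
  \<open>(k1 - k2) / s\<close>.\<close>

definition "k1' s = - 2 * k1 s * (k1 s - k2 s) / (s * k2 s)"
text \<open>Minus the Gauss-Kronecker curvature times the trace of the shape operator.\<close>

definition "multiplier s = - (k1 s * (k2 s)\<^sup>2 * (k1 s + 2 * k2 s))"

abbreviation "X \<equiv> rot_hypersurface f"
abbreviation "N \<equiv> rot_gauss_map f"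
abbreviation "U \<equiv> rot_domain I"

lemma N_nth: "N p $ a = (if a = 1 then \<nu> else \<mu>) (p$1) * lat a (p$2) * lon a (p$3)"
  using exhaust_4[of a] by (auto simp: rot_gauss_map_def ang_defs vector_4 \<nu>_def \<mu>_def)

lemma nu: assumes "s \<in> I" shows "\<nu> s > 0" "(\<nu> s)\<^sup>2 * ((deriv f s)\<^sup>2 - 1) = 1"
  using deriv_sq_gt_1[OF assms] by (simp_all add: \<nu>_def power_divide)

lemma smooth_deriv: "smooth_on I (deriv f)" "smooth_on I (deriv (deriv f))"
  using smooth_on_deriv open_I smooth_f by blast+

lemmas DERIV_f = smooth_on_DERIV[OF smooth_f] smooth_on_DERIV[OF smooth_deriv(1)]
  smooth_on_DERIV[OF smooth_deriv(2)]

lemma nonzero: assumes "s \<in> I" shows "s \<noteq> 0" "deriv f s \<noteq> 0" "\<mu> s \<noteq> 0" "k1 s \<noteq> 0" "k2 s \<noteq> 0"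
proof -
  show "s \<noteq> 0" using assms zero_notin_I by blast
  show "deriv f s \<noteq> 0" using deriv_sq_gt_1[OF assms] by auto
  then show "\<mu> s \<noteq> 0" using nu[OF assms] by (simp add: \<mu>_def)
  then show "k2 s \<noteq> 0" using \<open>s \<noteq> 0\<close> by (simp add: k2_def)
  show "k1 s \<noteq> 0" using nu[OF assms] deriv2_nonzero[OF assms] by (simp add: k1_def)
qed

lemma DERIV_nu: assumes "s \<in> I" shows "(\<nu> has_real_derivative - deriv f s * k1 s) (at s)"
proof -
  have pos: "(deriv f s)\<^sup>2 - 1 > 0" using deriv_sq_gt_1[OF assms] by simp
  have r: "sqrt ((deriv f s)\<^sup>2 - 1) ^ 3 = sqrt ((deriv f s)\<^sup>2 - 1) * ((deriv f s)\<^sup>2 - 1)"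
    using pos by (simp add: eval_nat_numeral)
  show ?thesis unfolding \<nu>_def[abs_def]
    using pos DERIV_f(2)[OF assms]
    by (auto intro!: derivative_eq_intros simp: k1_def \<nu>_def power_divide r field_simps)
qed

text \<open>The product rule gives \<open>deriv (deriv f) s * \<nu> s ^ 3\<close> times the
  difference of \<open>1 / (\<nu> s)\<^sup>2\<close> and \<open>(deriv f s)\<^sup>2\<close>, and
  that difference is -1.\<close>

lemma DERIV_mu: assumes "s \<in> I" shows "(\<mu> has_real_derivative - k1 s) (at s)"
proof -
  have "deriv f s * (- deriv f s * k1 s) + deriv (deriv f) s * \<nu> s = - k1 s"
    using nu(2)[OF assms] unfolding k1_def by algebra
  then show ?thesis unfolding \<mu>_def[abs_def]
    using DERIV_f(2)[OF assms] DERIV_nu[OF assms]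
    by (auto intro!: derivative_eq_intros simp: mult_ac)
qed

text \<open>The quotient rule applied to \<open>- \<mu> s / s\<close>; the result is the Codazzi
  equation linking the two principal curvatures.\<close>

lemma DERIV_k2: assumes "s \<in> I" shows "(k2 has_real_derivative (k1 s - k2 s) / s) (at s)"
  unfolding k2_def[abs_def]
  using DERIV_mu[OF assms] nonzero(1)[OF assms]
  by (auto intro!: derivative_eq_intros simp: field_simps power2_eq_square)

text \<open>The differential equation says that \<open>k1 * k2\<^sup>2\<close> is constant.\<close>

lemma DERIV_k1: assumes "s \<in> I" shows "(k1 has_real_derivative k1' s) (at s)"
proof -
  note nz = nonzero[OF assms] and nu = nu[OF assms]
  define v where "v = \<nu> s"
  define p where "p = deriv f s"
  define q where "q = deriv (deriv f) s"
  define r where "r = deriv (deriv (deriv f)) s"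
  have q: "q \<noteq> 0" using deriv2_nonzero[OF assms] by (simp add: q_def)
  have Wv: "v\<^sup>2 * (p\<^sup>2 - 1) = 1" using nu by (simp add: v_def p_def)
  then have Wn: "p\<^sup>2 - 1 \<noteq> 0" by auto
  have r: "r * (s * p * (p\<^sup>2 - 1)) = q * (s * (3 * p\<^sup>2 + 2) * q + 2 * p * (p\<^sup>2 - 1))"
    using ode[OF assms] q nz Wn unfolding p_def[symmetric] q_def[symmetric] r_def[symmetric]
    by (simp add: field_simps)
  \<comment> \<open>The first factor is the derivative of \<open>k1\<close> by the product rule. The
    factor \<open>s * p\<close> clears denominators, so that \<open>algebra\<close> can eliminate
    \<open>p\<^sup>2 - 1\<close> by means of \<open>Wv\<close>.\<close>
  have "(r * v^3 + q * (3 * v\<^sup>2 * (- p * (q * v^3)))) * (s * p) = 2 * q * v\<^sup>2 * (q * v^3 * s + p * v)"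
  proof -
    \<comment> \<open>This is \<open>r\<close> multiplied by \<open>v\<^sup>2\<close>, which turns
      \<open>v\<^sup>2 * (p\<^sup>2 - 1)\<close> into 1.\<close>
    have "r * s * p = q * (s * (3 * p\<^sup>2 + 2) * q * v\<^sup>2 + 2 * p)"
      using r Wv by algebra
    then show ?thesis using Wv by algebra
  qed
  then have "r * v^3 + q * (3 * v\<^sup>2 * (- p * (q * v^3))) = 2 * q * v\<^sup>2 * (q * v^3 * s + p * v) / (s * p)"
    using nz unfolding p_def[symmetric] by (simp add: eq_divide_eq)
  also have "\<dots> = k1' s"
    using nz nu unfolding k1'_def k1_def k2_def \<mu>_def v_def[symmetric] p_def[symmetric] q_def[symmetric]
    by (simp add: field_simps eval_nat_numeral)
  finally have "r * v^3 + q * (3 * v\<^sup>2 * (- p * (q * v^3))) = k1' s" .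
  then show ?thesis unfolding k1_def[abs_def]
    using DERIV_f(3)[OF assms] DERIV_nu[OF assms]
    by (auto intro!: derivative_eq_intros simp: v_def p_def q_def r_def k1_def algebra_simps)
qed

text \<open>The derivative of \<open>\<nu>\<close> is a smooth multiple of its cube, so
  \<open>\<nu>\<close> alone can serve as generator.\<close>

lemma smooth_nu: "smooth_on I \<nu>"
proof (rule smooth_on_real_algI[where G = "{\<nu>}"])
  fix h assume h: "h \<in> {\<nu>}"
  have "smooth_alg I {\<nu>} (\<lambda>s. - 1 * deriv f s * (deriv (deriv f) s * (\<nu> s * \<nu> s * \<nu> s)))"
    by (intro smooth_alg.mult smooth_alg.smooth[OF smooth_on_const] smooth_alg.smooth[OF smooth_deriv(1)]
        smooth_alg.smooth[OF smooth_deriv(2)] open_I smooth_alg.gen) auto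
  then show "\<exists>\<xi>. smooth_alg I {\<nu>} \<xi> \<and> (\<forall>x\<in>I. (h has_real_derivative \<xi> x) (at x))"
    using h DERIV_nu
    by (intro exI[of _ "\<lambda>s. - 1 * deriv f s * (deriv (deriv f) s * (\<nu> s * \<nu> s * \<nu> s))"])
      (auto simp: k1_def eval_nat_numeral mult_ac)
qed (auto simp: open_I)

lemma smooth_mu: "smooth_on I \<mu>"
  unfolding \<mu>_def[abs_def] by (intro smooth_on_mult open_I smooth_deriv smooth_nu)

lemma smooth_multiplier: "smooth_on I multiplier"
proof -
  have "smooth_on I k1"
    unfolding k1_def[abs_def] by (intro smooth_on_mult smooth_on_power open_I smooth_deriv smooth_nu)
  moreover have "smooth_on I k2"
    unfolding k2_def[abs_def] divide_inverse
    by (intro smooth_on_mult smooth_on_minus open_I smooth_mu smooth_on_inverse zero_notin_I)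
  ultimately show ?thesis
    unfolding multiplier_def[abs_def] by (intro smooth_on_mult smooth_on_add smooth_on_minus smooth_on_power smooth_on_const open_I)
qed

section \<open>Coordinate frame, metric and shape operator\<close>

lemma open_U: "open U"
proof -
  have "U = (\<lambda>p. p $ 1) -` I \<inter> {p. cos (p $ 2) \<noteq> 0}" by (auto simp: rot_domain_def)
  moreover have "open ((\<lambda>p::real^3. p $ 1) -` I)"
    by (intro open_vimage open_I continuous_intros)
  moreover have "open {p::real^3. cos (p $ 2) \<noteq> 0}"
    by (intro open_Collect_neq continuous_intros)
  ultimately show ?thesis by (simp add: open_Int)
qed

lemma U_D: "p \<in> U \<Longrightarrow> p $ 1 \<in> I" "p \<in> U \<Longrightarrow> cos (p $ 2) \<noteq> 0"
  by (auto simp: rot_domain_def)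

lemma smooth_on_U: "smooth_on I (g :: real \<Rightarrow> real) \<Longrightarrow> smooth_on U (\<lambda>p. g (p $ 1))"
  by (rule smooth_on_compose_nth[OF open_U, where J = I]) (auto simp: rot_domain_def)

lemma smooth_ang:
  "smooth_on U (\<lambda>p. lat a (p $ 2))" "smooth_on U (\<lambda>p. lon a (p $ 3))"
  by (rule smooth_on_compose_nth[OF open_U smooth_on_lat[OF open_UNIV]]
      smooth_on_compose_nth[OF open_U smooth_on_lon[OF open_UNIV]]; simp)+

lemma smooth_X_nth: "smooth_on U (\<lambda>p. X p $ a)"
  unfolding rot_hypersurface_nth
  by (intro smooth_on_mult open_U smooth_ang smooth_on_U) (auto simp: smooth_f smooth_on_ident open_I)

lemma smooth_N_nth: "smooth_on U (\<lambda>p. N p $ a)"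
  unfolding N_nth
  by (intro smooth_on_mult open_U smooth_ang smooth_on_U) (auto simp: smooth_nu smooth_mu)

text \<open>In the angular directions component 1 vanishes, since \<open>lat' 1\<close> and
  \<open>lon' 1\<close> are 0. Writing its radial factor as 0 makes the angular derivatives of
  \<open>X\<close> and \<open>N\<close> visibly proportional.\<close>

lemma pd_X:
  assumes "p \<in> U"
  shows "pd 1 X p $ a = (if a = 1 then deriv f (p$1) else 1) * lat a (p$2) * lon a (p$3)"
    and "pd 2 X p $ a = (if a = 1 then 0 else p$1) * lat' a (p$2) * lon a (p$3)"
    and "pd 3 X p $ a = (if a = 1 then 0 else p$1) * lat a (p$2) * lon' a (p$3)"
proof -
  have *: "pd i X p $ a = pd i (\<lambda>q. X q $ a) p" for i
    by (intro partial_deriv_nth(2) smooth_on_differentiable[OF smooth_X_nth] assms)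
  have "((if a = 1 then f else (\<lambda>s. s)) has_real_derivative (if a = 1 then deriv f (p$1) else 1)) (at (p$1))"
    using DERIV_f(1)[OF U_D(1)[OF assms]] by simp
  then show "pd 1 X p $ a = (if a = 1 then deriv f (p$1) else 1) * lat a (p$2) * lon a (p$3)"
    unfolding * rot_hypersurface_nth by (rule pd_separated)
  show "pd 2 X p $ a = (if a = 1 then 0 else p$1) * lat' a (p$2) * lon a (p$3)"
    unfolding * rot_hypersurface_nth pd_separated(2)[OF ang_DERIV(1)] by (simp add: lat'_def vector_4)
  show "pd 3 X p $ a = (if a = 1 then 0 else p$1) * lat a (p$2) * lon' a (p$3)"
    unfolding * rot_hypersurface_nth pd_separated(3)[OF ang_DERIV(3)] by (simp add: lon'_def vector_4)
qed

lemma pd_N: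
  assumes "p \<in> U"
  shows "pd 1 N p $ a = (if a = 1 then - deriv f (p$1) * k1 (p$1) else - k1 (p$1)) * lat a (p$2) * lon a (p$3)"
    and "pd 2 N p $ a = (if a = 1 then 0 else \<mu> (p$1)) * lat' a (p$2) * lon a (p$3)"
    and "pd 3 N p $ a = (if a = 1 then 0 else \<mu> (p$1)) * lat a (p$2) * lon' a (p$3)"
proof -
  have *: "pd i N p $ a = pd i (\<lambda>q. N q $ a) p" for i
    by (intro partial_deriv_nth(2) smooth_on_differentiable[OF smooth_N_nth] assms)
  have "((if a = 1 then \<nu> else \<mu>) has_real_derivative (if a = 1 then - deriv f (p$1) * k1 (p$1) else - k1 (p$1))) (at (p$1))"
    using DERIV_nu[OF U_D(1)[OF assms]] DERIV_mu[OF U_D(1)[OF assms]] by simp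
  then show "pd 1 N p $ a = (if a = 1 then - deriv f (p$1) * k1 (p$1) else - k1 (p$1)) * lat a (p$2) * lon a (p$3)"
    unfolding * N_nth by (rule pd_separated)
  show "pd 2 N p $ a = (if a = 1 then 0 else \<mu> (p$1)) * lat' a (p$2) * lon a (p$3)"
    unfolding * N_nth pd_separated(2)[OF ang_DERIV(1)] by (simp add: lat'_def vector_4)
  show "pd 3 N p $ a = (if a = 1 then 0 else \<mu> (p$1)) * lat a (p$2) * lon' a (p$3)"
    unfolding * N_nth pd_separated(3)[OF ang_DERIV(3)] by (simp add: lon'_def vector_4)
qed

definition "metric_coeff i p = (if i = (1::3) then 1 - (deriv f (p$1))\<^sup>2
  else if i = 2 then (p$1)\<^sup>2 else (p$1)\<^sup>2 * (cos (p$2))\<^sup>2)" for p :: "real^3"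

lemma metric_X:
  assumes "p \<in> U"
  shows "metric X p = diag_mat (\<lambda>i. metric_coeff i p)"
proof -
  have "(sin t)\<^sup>2 = 1 - (cos t)\<^sup>2" for t :: real by (simp add: sin_squared_eq)
  note sc = this[of "p$2"] this[of "p$3"]
  show ?thesis
    unfolding metric_def vec_eq_iff forall_3 lorentz_def
    using sc
    by (simp add: pd_X[OF assms] diag_mat_nth metric_coeff_def ang_defs vector_4; intro conjI; algebra)
qed

lemma metric_coeff_nonzero: "p \<in> U \<Longrightarrow> metric_coeff i p \<noteq> 0"
  using U_D[of p] nonzero[of "p$1"] deriv_sq_gt_1[of "p$1"] by (auto simp: metric_coeff_def)

text \<open>\<open>X\<close> and \<open>N\<close> share their angular factors, so their partial
  derivatives are proportional: \<open>pd j N\<close> is \<open>- k1\<close> times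
  \<open>pd j X\<close> for \<open>j = 1\<close>, and \<open>\<mu> / s\<close>, that is
  \<open>- k2\<close>, times it in both angles.\<close>

lemma shape_X:
  assumes "p \<in> U"
  shows "shape X N p = diag_mat (\<lambda>i. if i = 1 then k1 (p$1) else k2 (p$1))"
proof (rule shape_eq_diag_mat)
  show "invertible (metric X p)"
    using metric_X[OF assms] metric_coeff_nonzero[OF assms] by (simp add: invertible_diag_mat)
  have "\<mu> (p$1) = - k2 (p$1) * p$1"
    using nonzero[OF U_D(1)[OF assms]] by (simp add: k2_def)
  then show "- pd j N p = (if j = 1 then k1 (p$1) else k2 (p$1)) *\<^sub>R pd j X p" for j
    using exhaust_3[of j] pd_N[OF assms] pd_X[OF assms] by (auto simp: vec_eq_iff)
qed

text \<open>The sign is 1: the first metric coefficient \<open>1 - (deriv f s)\<^sup>2\<close> is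
  negative, so the \<open>s\<close> direction is timelike and the normal is spacelike.\<close>

lemma oriented: "oriented_hypersurface X N U"
proof -
  have t: "lorentz (pd i X p) (N p) = 0" if "p \<in> U" for i p
  proof -
    have "(sin t)\<^sup>2 = 1 - (cos t)\<^sup>2" for t :: real by (simp add: sin_squared_eq)
    note sc = this[of "p$2"] this[of "p$3"]
    have "lorentz (pd 1 X p) (N p) = 0"
      using sc by (simp add: lorentz_def pd_X[OF that] N_nth ang_defs vector_4 \<mu>_def) algebra
    moreover have "lorentz (pd 2 X p) (N p) = 0"
      using sc by (simp add: lorentz_def pd_X[OF that] N_nth ang_defs vector_4 \<mu>_def) algebra
    moreover have "lorentz (pd 3 X p) (N p) = 0"
      using sc by (simp add: lorentz_def pd_X[OF that] N_nth ang_defs vector_4 \<mu>_def)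
    ultimately show ?thesis using exhaust_3[of i] by blast
  qed
  have n: "lorentz (N p) (N p) = 1" if "p \<in> U" for p
  proof -
    have "(sin t)\<^sup>2 = 1 - (cos t)\<^sup>2" for t :: real by (simp add: sin_squared_eq)
    note sc = this[of "p$2"] this[of "p$3"] nu(2)[OF U_D(1)[OF that]]
    then show ?thesis
      by (simp add: lorentz_def N_nth ang_defs vector_4 \<mu>_def) algebra
  qed
  show ?thesis
    unfolding oriented_hypersurface_def
    using open_U smooth_on_vec[OF open_U smooth_X_nth] smooth_on_vec[OF open_U smooth_N_nth]
      metric_X metric_coeff_nonzero t n by (auto simp: invertible_diag_mat)
qed

section \<open>The Hessian and the operator applied to the Gauss map\<close>

lemma pd_metric_coeff:
  assumes "p \<in> U"
  shows "pd 1 (metric_coeff 1) p = - 2 * deriv f (p$1) * deriv (deriv f) (p$1)" "pd 2 (metric_coeff 1) p = 0" "pd 3 (metric_coeff 1) p = 0"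
    "pd 1 (metric_coeff 2) p = 2 * p$1" "pd 2 (metric_coeff 2) p = 0" "pd 3 (metric_coeff 2) p = 0"
    "pd 1 (metric_coeff 3) p = 2 * p$1 * (cos (p$2))\<^sup>2" "pd 2 (metric_coeff 3) p = - 2 * (p$1)\<^sup>2 * cos (p$2) * sin (p$2)"
    "pd 3 (metric_coeff 3) p = 0"
proof -
  let ?one = "\<lambda>_::real. 1::real"
  \<comment> \<open>Constant factors 1 bring the coefficients into the separated form.\<close>
  have d1: "metric_coeff 1 = (\<lambda>q. (\<lambda>s. 1 - (deriv f s)\<^sup>2) (q$1) * ?one (q$2) * ?one (q$3))"
    and d2: "metric_coeff 2 = (\<lambda>q. (\<lambda>s. s\<^sup>2) (q$1) * ?one (q$2) * ?one (q$3))"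
    and d3: "metric_coeff 3 = (\<lambda>q. (\<lambda>s. s\<^sup>2) (q$1) * (\<lambda>t. (cos t)\<^sup>2) (q$2) * ?one (q$3))"
    by (simp_all add: metric_coeff_def fun_eq_iff)
  have 1: "((\<lambda>s. 1 - (deriv f s)\<^sup>2) has_real_derivative - 2 * deriv f s * deriv (deriv f) s) (at s)"
    if "s \<in> I" for s
    using DERIV_f(2)[OF that] by (auto intro!: derivative_eq_intros)
  have 2: "((\<lambda>s::real. s\<^sup>2) has_real_derivative 2 * s) (at s)" for s
    by (auto intro!: derivative_eq_intros)
  have 3: "((\<lambda>t::real. (cos t)\<^sup>2) has_real_derivative - 2 * cos t * sin t) (at t)" for t
    by (auto intro!: derivative_eq_intros)
  show "pd 1 (metric_coeff 1) p = - 2 * deriv f (p$1) * deriv (deriv f) (p$1)" "pd 2 (metric_coeff 1) p = 0" "pd 3 (metric_coeff 1) p = 0"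
    using pd_separated(1)[where b = ?one and c = ?one, OF 1[OF U_D(1)[OF assms]]]
      pd_separated(2)[where a = "\<lambda>s. 1 - (deriv f s)\<^sup>2" and c = ?one, OF DERIV_const[of 1]]
      pd_separated(3)[where a = "\<lambda>s. 1 - (deriv f s)\<^sup>2" and b = ?one, OF DERIV_const[of 1]]
    by (simp_all add: d1)
  show "pd 1 (metric_coeff 2) p = 2 * p$1" "pd 2 (metric_coeff 2) p = 0" "pd 3 (metric_coeff 2) p = 0"
    using pd_separated(1)[where b = ?one and c = ?one, OF 2]
      pd_separated(2)[where a = "\<lambda>s. s\<^sup>2" and c = ?one, OF DERIV_const[of 1]]
      pd_separated(3)[where a = "\<lambda>s. s\<^sup>2" and b = ?one, OF DERIV_const[of 1]]
    by (simp_all add: d2)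
  show "pd 1 (metric_coeff 3) p = 2 * p$1 * (cos (p$2))\<^sup>2" "pd 2 (metric_coeff 3) p = - 2 * (p$1)\<^sup>2 * cos (p$2) * sin (p$2)"
    "pd 3 (metric_coeff 3) p = 0"
    using pd_separated(1)[where b = "\<lambda>t. (cos t)\<^sup>2" and c = ?one, OF 2] pd_separated(2)[where a = "\<lambda>s. s\<^sup>2" and c = ?one, OF 3]
      pd_separated(3)[where a = "\<lambda>s. s\<^sup>2" and b = "\<lambda>t. (cos t)\<^sup>2", OF DERIV_const[of 1]]
    by (simp_all add: d3)
qed

text \<open>Meant for \<open>c = \<nu>\<close> (component 1 of \<open>N\<close>) and
  \<open>c = \<mu>\<close> (the others). The dependence of the angular metric coefficients on
  \<open>s\<close> produces the terms with \<open>c' s\<close> in the last two entries, and the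
  factor \<open>(cos t)\<^sup>2\<close> of the third coefficient the term with
  \<open>sin t / cos t\<close>.\<close>

lemma hess_op_separated:
  fixes a c c' A B and p :: "real^3"
  defines "\<phi> \<equiv> \<lambda>q::real^3. c (q$1) * lat a (q$2) * lon a (q$3)"
  assumes p: "p \<in> U" and s: "s = p$1" and t: "t = p$2" and w: "w = p$3"
    and c: "\<forall>s\<in>I. (c has_real_derivative c' s) (at s)"
    and c': "(c' has_real_derivative c'') (at s)"
  shows "hess_op X \<phi> p $ 1 $ 1 = (- c'' * (\<nu> s)\<^sup>2 + deriv f s * deriv (deriv f) s * (\<nu> s)^4 * c' s) * lat a t * lon a w"
    and "hess_op X \<phi> p $ 2 $ 2 = c s / s\<^sup>2 * lat'' a t * lon a w - c' s * (\<nu> s)\<^sup>2 / s * lat a t * lon a w"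
    and "hess_op X \<phi> p $ 3 $ 3 = c s / s\<^sup>2 * (lat a t * lon'' a w / (cos t)\<^sup>2 - sin t / cos t * (lat' a t * lon a w))
      - c' s * (\<nu> s)\<^sup>2 / s * lat a t * lon a w"
proof -
  have sI: "s \<in> I" and ct: "cos t \<noteq> 0" using U_D[OF p] by (simp_all add: s t)
  have s0: "s \<noteq> 0" using nonzero[OF sI] by simp
  have pd1: "pd 1 \<phi> q = c' (q$1) * lat a (q$2) * lon a (q$3)" if "q \<in> U" for q
    unfolding \<phi>_def by (rule pd_separated(1)[OF c[rule_format, OF U_D(1)[OF that]]])
  have pd2: "pd 2 \<phi> q = c (q$1) * lat' a (q$2) * lon a (q$3)" for q
    unfolding \<phi>_def by (rule pd_separated(2)[OF ang_DERIV(1)])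
  have pd3: "pd 3 \<phi> q = c (q$1) * lat a (q$2) * lon' a (q$3)" for q
    unfolding \<phi>_def by (rule pd_separated(3)[OF ang_DERIV(3)])
  have hess: "hess_op X \<phi> p $ i $ i = pd i (\<lambda>q. pd i \<phi> q / metric_coeff i q) p
    + (\<Sum>l\<in>UNIV. pd l (metric_coeff i) p / (2 * metric_coeff i p) * (pd l \<phi> p / metric_coeff l p))" for i
    by (rule hess_op_diagonal[OF open_U p metric_X metric_coeff_nonzero])
  \<comment> \<open>The first metric coefficient is \<open>- 1 / V\<close>, so division by it
    becomes multiplication by \<open>- V\<close>.\<close>
  define V where "V = (\<nu> s)\<^sup>2"
  define f1 where "f1 = deriv f s"
  define f2 where "f2 = deriv (deriv f) s"
  have V: "1 - f1\<^sup>2 = - 1 / V" "V \<noteq> 0" "\<nu> s ^ 4 = V\<^sup>2"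
    using nu[OF sI] by (auto simp: V_def f1_def field_simps)
  have metric_coeff: "metric_coeff 1 p = - 1 / V" "metric_coeff 2 p = s\<^sup>2" "metric_coeff 3 p = s\<^sup>2 * (cos t)\<^sup>2"
    using V(1) by (simp_all add: metric_coeff_def f1_def s t)

  have "pd 1 (\<lambda>q. pd 1 \<phi> q / metric_coeff 1 q) p
      = pd 1 (\<lambda>q. (\<lambda>s. c' s / (1 - (deriv f s)\<^sup>2)) (q$1) * lat a (q$2) * lon a (q$3)) p"
    by (rule partial_deriv_cong[OF open_U p]) (simp add: pd1 metric_coeff_def)
  also have "\<dots> = (- c'' * V + 2 * c' s * f1 * f2 * V\<^sup>2) * lat a t * lon a w"
    unfolding t w
  proof (rule pd_separated(1))
    have "((\<lambda>s. c' s / (1 - (deriv f s)\<^sup>2)) has_real_derivative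
        (c'' * (1 - (deriv f s)\<^sup>2) - c' s * (0 - 2 * deriv f s * deriv (deriv f) s)) /
          ((1 - (deriv f s)\<^sup>2) * (1 - (deriv f s)\<^sup>2))) (at s)"
      using deriv_sq_gt_1[OF sI] DERIV_f(2)[OF sI] c' by (auto intro!: derivative_eq_intros)
    also have "(c'' * (1 - (deriv f s)\<^sup>2) - c' s * (0 - 2 * deriv f s * deriv (deriv f) s)) /
          ((1 - (deriv f s)\<^sup>2) * (1 - (deriv f s)\<^sup>2)) = - c'' * V + 2 * c' s * f1 * f2 * V\<^sup>2"
      unfolding f1_def[symmetric] f2_def[symmetric] V(1) using V(2)
      by (simp add: field_simps power2_eq_square)
    finally show "((\<lambda>s. c' s / (1 - (deriv f s)\<^sup>2)) has_real_derivative
        - c'' * V + 2 * c' s * f1 * f2 * V\<^sup>2) (at (p$1))"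
      by (simp add: s)
  qed
  \<comment> \<open>The Christoffel term is \<open>- f1 * f2 * V\<^sup>2 * c' s\<close> times the
    angular factors, which halves the corresponding coefficient in the differentiated
    gradient.\<close>
  finally show "hess_op X \<phi> p $ 1 $ 1 = (- c'' * (\<nu> s)\<^sup>2 + deriv f s * deriv (deriv f) s * (\<nu> s)^4 * c' s) * lat a t * lon a w"
    unfolding hess V(3) using V(2)
    by (simp add: sum_3 pd_metric_coeff[OF p] metric_coeff pd1[OF p] V_def[symmetric] f1_def[symmetric] f2_def[symmetric]
        s[symmetric] t[symmetric] w[symmetric]) (simp add: field_simps power2_eq_square)

  have "pd 2 (\<lambda>q. pd 2 \<phi> q / metric_coeff 2 q) p
      = pd 2 (\<lambda>q. (\<lambda>s. c s / s\<^sup>2) (q$1) * lat' a (q$2) * lon a (q$3)) p"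
    by (rule partial_deriv_cong[OF open_U p]) (simp add: pd2 metric_coeff_def)
  also have "\<dots> = c s / s\<^sup>2 * lat'' a t * lon a w"
    unfolding s t w by (rule pd_separated(2)[OF ang_DERIV(2)])
  finally show "hess_op X \<phi> p $ 2 $ 2 = c s / s\<^sup>2 * lat'' a t * lon a w - c' s * (\<nu> s)\<^sup>2 / s * lat a t * lon a w"
    unfolding hess using V(2) s0
    by (simp add: sum_3 pd_metric_coeff[OF p] metric_coeff pd1[OF p] V_def[symmetric] 
        s[symmetric] t[symmetric] w[symmetric]) (simp add: field_simps power2_eq_square)

  have "pd 3 (\<lambda>q. pd 3 \<phi> q / metric_coeff 3 q) p
      = pd 3 (\<lambda>q. (\<lambda>s. c s / s\<^sup>2) (q$1) * (\<lambda>t. lat a t / (cos t)\<^sup>2) (q$2) * lon' a (q$3)) p"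
    by (rule partial_deriv_cong[OF open_U p]) (simp add: pd3 metric_coeff_def)
  also have "\<dots> = c s / s\<^sup>2 * (lat a t / (cos t)\<^sup>2) * lon'' a w"
    unfolding s t w by (rule pd_separated(3)[OF ang_DERIV(4)])
  finally show "hess_op X \<phi> p $ 3 $ 3 = c s / s\<^sup>2 * (lat a t * lon'' a w / (cos t)\<^sup>2 - sin t / cos t * (lat' a t * lon a w))
      - c' s * (\<nu> s)\<^sup>2 / s * lat a t * lon a w"
    unfolding hess using V(2) s0 ct
    by (simp add: sum_3 pd_metric_coeff[OF p] metric_coeff pd1[OF p] pd2 V_def[symmetric] 
        s[symmetric] t[symmetric] w[symmetric]) (simp add: field_simps power2_eq_square)
qed

text \<open>The Newton transformation has eigenvalues \<open>b * b\<close>, \<open>a * b\<close>,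
  \<open>a * b\<close>, so the two angular Hessian entries enter only through their sum. Component 1
  has constant angular factors; for the others \<open>sphere_laplacian\<close> evaluates the angular
  part of that sum. The derivative \<open>k1'\<close> then reduces everything to a polynomial
  identity.\<close>

lemma L_2_N:
  assumes p: "p \<in> U"
  shows "L_op_vec 2 X N N p = multiplier (p$1) *\<^sub>R N p"
proof -
  define s t w where "s = p$1" "t = p$2" "w = p$3"
  note stw = s_t_w_def
  have sI: "s \<in> I" and ct: "cos t \<noteq> 0" using U_D[OF p] by (simp_all add: stw)
  have nu': "\<forall>s\<in>I. (\<nu> has_real_derivative - deriv f s * k1 s) (at s)"
    and mu': "\<forall>s\<in>I. (\<mu> has_real_derivative - k1 s) (at s)"
    using DERIV_nu DERIV_mu by blast+
  note nz = nonzero[OF sI]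
  define v where "v = \<nu> s"
  define f1 where "f1 = deriv f s"
  define f2 where "f2 = deriv (deriv f) s"
  define a where "a = k1 s"
  define b where "b = k2 s"
  define a' where "a' = k1' s"
  note defs = v_def[symmetric] f1_def[symmetric] f2_def[symmetric] a_def[symmetric] b_def[symmetric] a'_def[symmetric]
  have v: "v \<noteq> 0" "v\<^sup>2 * (f1\<^sup>2 - 1) = 1" using nu[OF sI] by (auto simp: defs)
  have a: "a = f2 * v^3" by (simp add: a_def k1_def defs)
  have fv: "f1 * v = - s * b" using nz by (simp add: b_def k2_def \<mu>_def defs)
  have mu: "\<mu> s = - s * b" using nz by (simp add: b_def k2_def)
  have a': "a' * (s * b) = - 2 * a * (a - b)" using nz by (simp add: a'_def k1'_def a_def b_def)
  have L: "L_op 2 X N \<phi> p = b * b * hess_op X \<phi> p $ 1 $ 1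
    + a * b * (hess_op X \<phi> p $ 2 $ 2 + hess_op X \<phi> p $ 3 $ 3)" for \<phi>
    using L_op_2_diag_mat[OF shape_X[OF p], of \<phi>] by (simp add: a_def b_def stw algebra_simps)

  have 1: "L_op 2 X N (\<lambda>q. N q $ 1) p = multiplier s * N p $ 1"
  proof -
    have "((\<lambda>s. - deriv f s * k1 s) has_real_derivative - f2 * a - f1 * a') (at s)"
      using DERIV_f(2)[OF sI] DERIV_k1[OF sI]
      by (auto intro!: derivative_eq_intros simp: defs algebra_simps)
    note h = hess_op_separated[OF p stw nu' this, where a = 1]
    have N1: "(\<lambda>q. N q $ 1) = (\<lambda>q. \<nu> (q$1) * lat 1 (q$2) * lon 1 (q$3))"
      by (simp add: N_nth fun_eq_iff)
    have "L_op 2 X N (\<lambda>q. N q $ 1) p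
      = b * b * ((f2 * a + f1 * a') * v\<^sup>2 - f1 * f2 * v^4 * (f1 * a)) + 2 * a * b * (f1 * a * v\<^sup>2 / s)"
      unfolding L N1 h
      by (simp add: ang_defs vector_4 defs algebra_simps)
    also have "\<dots> = - (a * b\<^sup>2 * (a + 2 * b)) * v"
    proof -
      \<comment> \<open>Division by \<open>s\<close> is replaced by a variable with
        \<open>r * s = 1\<close>, which makes the claim polynomial and accessible to
        \<open>algebra\<close>.\<close>
      define r where "r = 1 / s"
      have r: "r * s = 1" using nz by (simp add: r_def)
      have "b * b * ((f2 * a + f1 * a') * v\<^sup>2 - f1 * f2 * v^4 * (f1 * a)) + 2 * a * b * (f1 * a * v\<^sup>2 * r)
        = - (a * b\<^sup>2 * (a + 2 * b)) * v"
        using r v(2) a fv a' by algebra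
      then show ?thesis by (simp add: r_def)
    qed
    finally show ?thesis
      by (simp add: multiplier_def N_nth ang_defs vector_4 defs stw[symmetric])
  qed
  have 2: "L_op 2 X N (\<lambda>q. N q $ i) p = multiplier s * N p $ i" if "i \<noteq> 1" for i
  proof -
    define y where "y = lat i t * lon i w"
    \<comment> \<open>\<open>z\<close> collects the angular parts of the second and third Hessian
      entries: it is the sphere Laplacian of \<open>y\<close>.\<close>
    define z where "z = lat'' i t * lon i w + lat i t * lon'' i w / (cos t)\<^sup>2 - sin t / cos t * (lat' i t * lon i w)"
    have z: "z = - 2 * y" unfolding z_def y_def by (rule sphere_laplacian[OF ct that])
    have "((\<lambda>s. - k1 s) has_real_derivative - a') (at s)"
      using DERIV_k1[OF sI] by (auto intro!: derivative_eq_intros simp: defs)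
    note h = hess_op_separated[OF p stw mu' this, where a = i]
    have "L_op 2 X N (\<lambda>q. N q $ i) p
      = b * b * (a' * v\<^sup>2 - f1 * f2 * v^4 * a) * y + a * b * (\<mu> s / s\<^sup>2 * z + 2 * a * v\<^sup>2 / s * y)"
      unfolding L N_nth if_not_P[OF that] h
      by (simp add: defs y_def z_def algebra_simps)
    also have "\<dots> = - (a * b\<^sup>2 * (a + 2 * b)) * \<mu> s * y"
    proof -
      define r where "r = 1 / s"
      have r: "r * s = 1" using nz by (simp add: r_def)
      have "b * b * (a' * v\<^sup>2 - f1 * f2 * v^4 * a) * y + a * b * ((- s * b) * r\<^sup>2 * (- 2 * y) + 2 * a * v\<^sup>2 * r * y)
        = - (a * b\<^sup>2 * (a + 2 * b)) * (- s * b) * y"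
        using r v(2) a fv a' by algebra
      then show ?thesis by (simp add: r_def z mu power_divide)
    qed
    finally show ?thesis
      by (simp add: multiplier_def N_nth that y_def defs stw[symmetric])
  qed
  have "L_op 2 X N (\<lambda>q. N q $ i) p = multiplier s * N p $ i" for i
    by (cases "i = 1") (simp_all add: 1 2)
  then show ?thesis
    by (auto simp: L_op_vec_def vec_eq_iff stw[symmetric])
qed

section \<open>Non-vanishing of the factor and its descent to the point set\<close>

lemma multiplier_nonzero: "\<exists>s\<in>I. multiplier s \<noteq> 0"
proof (rule ccontr)
  assume "\<not> ?thesis"
  then have z: "k1 s = - 2 * k2 s" if "s \<in> I" for s
    using that nonzero[OF that] by (auto simp: multiplier_def)
  obtain s where s: "s \<in> I" using nonempty_I by blast
  note nz = nonzero[OF s]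
  have "((\<lambda>s. - 2 * k2 s) has_real_derivative - 2 * ((k1 s - k2 s) / s)) (at s)"
    using DERIV_cmult[OF DERIV_k2[OF s], of "-2"] .
  \<comment> \<open>The relation \<open>z\<close> holds on the open set \<open>I\<close>, so it may
    be differentiated.\<close>
  then have "(k1 has_real_derivative - 2 * ((k1 s - k2 s) / s)) (at s)"
    by (rule has_field_derivative_transform_within_open[OF _ open_I s]) (simp add: z)
  then have "k1' s = - 2 * ((k1 s - k2 s) / s)"
    using DERIV_k1[OF s] DERIV_unique by blast
  \<comment> \<open>After substituting \<open>k1 s = - 2 * k2 s\<close>, the left side is
    \<open>- 12 * k2 s / s\<close> and the right side \<open>6 * k2 s / s\<close>, although
    \<open>k2 s\<close> is nonzero.\<close>
  then show False
    using nz unfolding k1'_def z[OF s] by (simp add: field_simps)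
qed

lemma first_kind: "first_kind_L_pointwise_1_type_gauss_map 2 X N U"
proof -
  obtain s0 where s0: "s0 \<in> I" using nonempty_I by blast
  \<comment> \<open>With different signs, 0 would lie between \<open>s\<close> and
    \<open>s0\<close>, hence in the interval \<open>I\<close>.\<close>
  have sgn: "sgn s = sgn s0" if "s \<in> I" for s
  proof (rule ccontr)
    assume "sgn s \<noteq> sgn s0"
    then have "s \<le> 0 \<and> 0 \<le> s0 \<or> s0 \<le> 0 \<and> 0 \<le> s" by (auto simp: sgn_if split: if_splits)
    then show False using mem_is_interval_1_I[OF interval_I] s0 that zero_notin_I by blast
  qed
  define m :: "real^4 \<Rightarrow> real"
    where "m x = multiplier (sgn s0 * sqrt ((x$2)\<^sup>2 + (x$3)\<^sup>2 + (x$4)\<^sup>2))" for x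
  have m: "m (X p) = multiplier (p$1)" if "p$1 \<in> I" for p
  proof -
    have "(X p $ 2)\<^sup>2 + (X p $ 3)\<^sup>2 + (X p $ 4)\<^sup>2 = (p$1)\<^sup>2"
      by (simp add: rot_hypersurface_def vector_4 power_mult_distrib sin_squared_eq algebra_simps)
    then show ?thesis
      by (simp add: m_def sgn[OF that, symmetric] abs_mult_sgn sgn_mult_abs mult.commute)
  qed
  have "smooth_on U (m \<circ> X)"
    by (rule smooth_on_cong[OF open_U smooth_on_U[OF smooth_multiplier]]) (simp add: m U_D(1))
  moreover obtain s where s: "s \<in> I" "multiplier s \<noteq> 0" using multiplier_nonzero by blast
  \<comment> \<open>At \<open>t = 0\<close> the cosine is 1, so every \<open>s\<close> in
    \<open>I\<close> is attained at a point of the domain.\<close>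
  have "vector [s, 0, 0] \<in> U" using s by (simp add: rot_domain_def)
  then have "\<exists>q\<in>X ` U. m q \<noteq> 0"
    using m[of "vector [s, 0, 0]"] s by (auto intro!: bexI[of _ "vector [s, 0, 0]"])
  ultimately show ?thesis
    unfolding first_kind_L_pointwise_1_type_gauss_map_def
    using oriented L_2_N m U_D(1) by (intro conjI exI[of _ m]) auto
qed

end

theorem theorem14:
  fixes f :: "real \<Rightarrow> real" and I :: "real set"
  assumes "open I" and "is_interval I" and "I \<noteq> {}" and "0 \<notin> I"
    and "smooth_on I f"
    and "\<And>s. s \<in> I \<Longrightarrow> (deriv f s)\<^sup>2 > 1"
    and "\<And>s. s \<in> I \<Longrightarrow> deriv (deriv f) s \<noteq> 0"
    and "\<And>s. s \<in> I \<Longrightarrow>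
      deriv (deriv (deriv f)) s / deriv (deriv f) s =
        (s * (3 * (deriv f s)\<^sup>2 + 2) * deriv (deriv f) s + 2 * deriv f s * ((deriv f s)\<^sup>2 - 1))
        / (s * deriv f s * ((deriv f s)\<^sup>2 - 1))"
  shows "first_kind_L_pointwise_1_type_gauss_map 2
    (rot_hypersurface f) (rot_gauss_map f) (rot_domain I)"
proof -
  interpret profile f I
    by unfold_locales (fact assms)+
  show ?thesis by (rule first_kind)
qed

end
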